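(* Let $\gamma,\gamma^\dagger\in D(F)$ satisfy $\left\|\frac{\gamma-\gamma^\dagger}{\gamma^\dagger}\right\|_{L^\infty}<1$, and set $B(\gamma,\gamma^\dagger):=\Lambda_\gamma-\Lambda_{\gamma^\dagger}-\Lambda'_\gamma(\gamma-\gamma^\dagger)$ and $\Delta\gamma:=(\gamma-\gamma^\dagger)/(\gamma^\dagger)^{1/2}$. Then: (i) for every $f\in H^{1/2}(\partial\Omega)$, $$\langle B(\gamma,\gamma^\dagger)f,f\rangle\le\inf\Big\{\|\Delta\gamma\,\nabla u_{\gamma,f}-w\|_{L^2(\Omega)^n}^2:\ w\in L^2(\Omega)^n,\ \operatorname{div}((\gamma^\dagger)^{1/2}w)=0\Big\};$$ (ii) $B(\gamma,\gamma^\dagger)\preceq\Lambda'_\gamma\!\left(\frac{|\gamma-\gamma^\dagger|^2}{\gamma^\dagger}\right)-(\Lambda_\gamma-\Lambda_{\gamma^\dagger})\Lambda_{\gamma^\dagger}^{-1}(\Lambda_\gamma-\Lambda_{\gamma^\dagger})$; (iii) $B(\gamma,\gamma^\dagger)\preceq\Lambda'_\gamma\!\left(\frac{|\gamma-\gamma^\dagger|^2}{\gamma^\dagger}\right)-\Lambda'_\gamma\!\left(\frac{(\gamma-\gamma^\dagger)\gamma}{\gamma^\dagger}\right)\Big[\Lambda'_\gamma\!\left(\frac{\gamma^2}{\gamma^\dagger}\right)\Big]^{-1}\Lambda'_\gamma\!\left(\frac{(\gamma-\gamma^\dagger)\gamma}{\gamma^\dagger}\right)$. (Equivalently, (ii)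 and (iii) state that for all $f,g\in H^{1/2}(\partial\Omega)$: $\langle Bf,f\rangle\le\langle\Lambda'_\gamma(\frac{|\gamma-\gamma^\dagger|^2}{\gamma^\dagger})f,f\rangle-2\langle(\Lambda_\gamma-\Lambda_{\gamma^\dagger})f,g\rangle+\langle\Lambda_{\gamma^\dagger}g,g\rangle$, respectively $\langle Bf,f\rangle\le\langle\Lambda'_\gamma(\frac{|\gamma-\gamma^\dagger|^2}{\gamma^\dagger})f,f\rangle-2\langle\Lambda'_\gamma(\frac{(\gamma-\gamma^\dagger)\gamma}{\gamma^\dagger})f,g\rangle+\langle\Lambda'_\gamma(\frac{\gamma^2}{\gamma^\dagger})g,g\rangle$.)
   Context: Let $\Omega\subset\mathbb{R}^n$ be a bounded Lipschitz domain and $0<\underline{\alpha}\le\overline{\alpha}$ fixed constants. A conductivity is a function $\gamma\in L^\infty(\Omega)$ with $\underline{\alpha}\le\gamma\le\overline{\alpha}$ a.e. For a conductivity $\gamma$ and $f\in H^{1/2}(\partial\Omega)$, $u_{\gamma,f}\in H^1(\Omega)$ is the weak solution of $\operatorname{div}(\gamma\nabla u)=0$ in $\Omega$, $u=f$ on $\partial\Omega$. Boundary data are considered modulo additive constants, and $H^{1/2}(\partial\Omega)$ carries the Hilbert norm $\|f\|:=\|\nabla u_{1,f}\|_{L^2(\Omega)^n}$; $\langle\cdot,\cdot\rangle$ is the duality pairing of $H^{-1/2}(\partial\Omega)$ with $H^{1/2}(\partial\Omega)$. The Dirichlet-to-Neumann map $\Lambda_\gamma:H^{1/2}(\partial\Omega)\to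 H^{-1/2}(\partial\Omega)$ is the bounded symmetric operator with $\langle\Lambda_\gamma f,g\rangle=\int_\Omega\gamma\nabla u_{\gamma,f}\cdot\nabla u_{\gamma,g}\,dx$; for conductivities $\gamma_1,\gamma_2$ one has $\langle(\Lambda_{\gamma_1}-\Lambda_{\gamma_2})f,g\rangle=\int_\Omega(\gamma_1-\gamma_2)\nabla u_{\gamma_1,f}\cdot\nabla u_{\gamma_2,g}\,dx$. For $w\in L^\infty(\Omega)$, $\Lambda'_\gamma(w)$ denotes the symmetric operator with $\langle\Lambda'_\gamma(w)f,g\rangle=\int_\Omega w\,\nabla u_{\gamma,f}\cdot\nabla u_{\gamma,g}\,dx$ (the Fréchet derivative of $\gamma\mapsto\Lambda_\gamma$ at $\gamma$ in direction $w$). On $H^{1/2}(\partial\Omega)$ modulo constants, $\Lambda_{\gamma^\dagger}$ and $\Lambda'_\gamma(\gamma^2/\gamma^\dagger)$ are coercive and hence invertible onto the annihilator of constants in $H^{-1/2}(\partial\Omega)$; their inverses are meant in this sense. For symmetric bounded operators $A,B:H^{1/2}(\partial\Omega)\to H^{-1/2}(\partial\Omega)$, $A\preceq B$ (Löwner order) means $\langle Af,f\rangle\le\langle Bf,f\rangle$ for all $f$. Let $(f_i)_{i\in I}$ be a finite or countably infinite orthonormal family in $H^{1/2}(\partial\Omega)$. For a symmetric operator $A:H^{1/2}\to H^{-1/2}$ put $\|A\|_Y^2:=\sum_{i,j\in I}|\langle Af_i,f_j\rangle|^2\in[0,\infty]$. Let $D(F)$ be the set of conductivities $\gamma$ with $\|\Lambda_\gamma-\Lambda_1\|_Y<\infty$.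 *)

theory Defs
  imports "HOL-Analysis.Analysis"
begin

definition lipschitz_domain :: "'a::euclidean_space set \<Rightarrow> bool" where
  "lipschitz_domain \<Omega> \<longleftrightarrow> open \<Omega> \<and> connected \<Omega> \<and> \<Omega> \<noteq> {} \<and> bounded \<Omega> \<and>
     (\<forall>x\<in>frontier \<Omega>. \<exists>(e::'a) r L (h::'a \<Rightarrow> real). norm e = 1 \<and> r > 0 \<and>
        L-lipschitz_on UNIV h \<and>
        \<Omega> \<inter> ball x r = {y \<in> ball x r. y \<bullet> e < h (y - (y \<bullet> e) *\<^sub>R e)})"

definition L2_on :: "'a::euclidean_space set \<Rightarrow> ('a \<Rightarrow> 'b::real_normed_vector) \<Rightarrow> bool" where
  "L2_on \<Omega> u \<longleftrightarrow> u \<in> borel_measurable (lebesgue_on \<Omega>) \<and>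
     integrable (lebesgue_on \<Omega>) (\<lambda>x. (norm (u x))\<^sup>2)"

definition test_fun :: "'a::euclidean_space set \<Rightarrow> ('a \<Rightarrow> real) \<Rightarrow> ('a \<Rightarrow> 'a) \<Rightarrow> bool" where
  "test_fun \<Omega> \<phi> D\<phi> \<longleftrightarrow> (\<forall>x. (\<phi> has_derivative (\<lambda>h. D\<phi> x \<bullet> h)) (at x)) \<and>
     continuous_on UNIV D\<phi> \<and> compact (closure {x. \<phi> x \<noteq> 0}) \<and> closure {x. \<phi> x \<noteq> 0} \<subseteq> \<Omega>"

definition weak_grad :: "'a::euclidean_space set \<Rightarrow> ('a \<Rightarrow> real) \<Rightarrow> ('a \<Rightarrow> 'a) \<Rightarrow> bool" where
  "weak_grad \<Omega> u G \<longleftrightarrow> (\<forall>\<phi> D\<phi>. test_fun \<Omega> \<phi> D\<phi> \<longrightarrow>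
     integral\<^sup>L (lebesgue_on \<Omega>) (\<lambda>x. u x *\<^sub>R D\<phi> x) =
       - integral\<^sup>L (lebesgue_on \<Omega>) (\<lambda>x. \<phi> x *\<^sub>R G x))"

definition H1 :: "'a::euclidean_space set \<Rightarrow> ('a \<Rightarrow> real) \<Rightarrow> bool" where
  "H1 \<Omega> u \<longleftrightarrow> L2_on \<Omega> u \<and> (\<exists>G. L2_on \<Omega> G \<and> weak_grad \<Omega> u G)"

text \<open>The weak gradient (unique up to null sets).\<close>
definition grad :: "'a::euclidean_space set \<Rightarrow> ('a \<Rightarrow> real) \<Rightarrow> 'a \<Rightarrow> 'a" where
  "grad \<Omega> u = (SOME G. L2_on \<Omega> G \<and> weak_grad \<Omega> u G)"

definition H1_0 :: "'a::euclidean_space set \<Rightarrow> ('a \<Rightarrow> real) \<Rightarrow> bool" where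
  "H1_0 \<Omega> u \<longleftrightarrow> H1 \<Omega> u \<and> (\<exists>\<phi> D\<phi>. (\<forall>k::nat. test_fun \<Omega> (\<phi> k) (D\<phi> k)) \<and>
     ((\<lambda>k. integral\<^sup>L (lebesgue_on \<Omega>) (\<lambda>x. (u x - \<phi> k x)\<^sup>2)
         + integral\<^sup>L (lebesgue_on \<Omega>) (\<lambda>x. (norm (grad \<Omega> u x - D\<phi> k x))\<^sup>2)) \<longlonglongrightarrow> 0))"

definition conductivity :: "'a::euclidean_space set \<Rightarrow> real \<Rightarrow> real \<Rightarrow> ('a \<Rightarrow> real) \<Rightarrow> bool" where
  "conductivity \<Omega> lo hi \<gamma> \<longleftrightarrow> \<gamma> \<in> borel_measurable (lebesgue_on \<Omega>) \<and>
     (AE x in lebesgue_on \<Omega>. lo \<le> \<gamma> x \<and> \<gamma> x \<le> hi)"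

text \<open>Boundary data f in H^{1/2}(boundary) are represented by any F in H^1(\<Omega>) with
  trace f.  u is the weak solution of div(\<gamma> grad u) = 0 with u - F in H^1_0.\<close>
definition is_sol :: "'a::euclidean_space set \<Rightarrow> ('a \<Rightarrow> real) \<Rightarrow> ('a \<Rightarrow> real) \<Rightarrow> ('a \<Rightarrow> real) \<Rightarrow> bool" where
  "is_sol \<Omega> \<gamma> F u \<longleftrightarrow> H1 \<Omega> u \<and> H1_0 \<Omega> (\<lambda>x. u x - F x) \<and>
     (\<forall>v. H1_0 \<Omega> v \<longrightarrow>
        integral\<^sup>L (lebesgue_on \<Omega>) (\<lambda>x. \<gamma> x * (grad \<Omega> u x \<bullet> grad \<Omega> v x)) = 0)"

definition sol :: "'a::euclidean_space set \<Rightarrow> ('a \<Rightarrow> real) \<Rightarrow> ('a \<Rightarrow> real) \<Rightarrow> 'a \<Rightarrow> real" where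
  "sol \<Omega> \<gamma> F = (SOME u. is_sol \<Omega> \<gamma> F u)"

text \<open>Bilinear form of the Dirichlet-to-Neumann map: <Lambda_gamma f, g>.\<close>
definition DN :: "'a::euclidean_space set \<Rightarrow> ('a \<Rightarrow> real) \<Rightarrow> ('a \<Rightarrow> real) \<Rightarrow> ('a \<Rightarrow> real) \<Rightarrow> real" where
  "DN \<Omega> \<gamma> F G = integral\<^sup>L (lebesgue_on \<Omega>)
     (\<lambda>x. \<gamma> x * (grad \<Omega> (sol \<Omega> \<gamma> F) x \<bullet> grad \<Omega> (sol \<Omega> \<gamma> G) x))"

text \<open>Bilinear form of the Frechet derivative: <Lambda'_gamma(w) f, g>.\<close>
definition DNd :: "'a::euclidean_space set \<Rightarrow> ('a \<Rightarrow> real) \<Rightarrow> ('a \<Rightarrow> real) \<Rightarrow> ('a \<Rightarrow> real) \<Rightarrow> ('a \<Rightarrow> real) \<Rightarrow> real" where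
  "DNd \<Omega> \<gamma> w F G = integral\<^sup>L (lebesgue_on \<Omega>)
     (\<lambda>x. w x * (grad \<Omega> (sol \<Omega> \<gamma> F) x \<bullet> grad \<Omega> (sol \<Omega> \<gamma> G) x))"

text \<open>Orthonormal family (f_i), i in I (I a subset of nat, i.e. finite or countable),
  w.r.t. the inner product of H^{1/2} induced by the norm ||grad u_{1,f}||.\<close>
definition orthonormal_fam :: "'a::euclidean_space set \<Rightarrow> nat set \<Rightarrow> (nat \<Rightarrow> 'a \<Rightarrow> real) \<Rightarrow> bool" where
  "orthonormal_fam \<Omega> I fam \<longleftrightarrow> (\<forall>i\<in>I. H1 \<Omega> (fam i)) \<and>
     (\<forall>i\<in>I. \<forall>j\<in>I. DN \<Omega> (\<lambda>_. 1) (fam i) (fam j) = (if i = j then 1 else 0))"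

text \<open>D(F): conductivities with ||Lambda_gamma - Lambda_1||_Y finite.\<close>
definition in_DF :: "'a::euclidean_space set \<Rightarrow> real \<Rightarrow> real \<Rightarrow> nat set \<Rightarrow> (nat \<Rightarrow> 'a \<Rightarrow> real) \<Rightarrow> ('a \<Rightarrow> real) \<Rightarrow> bool" where
  "in_DF \<Omega> lo hi I fam \<gamma> \<longleftrightarrow> conductivity \<Omega> lo hi \<gamma> \<and>
     (\<lambda>(i,j). (DN \<Omega> \<gamma> (fam i) (fam j) - DN \<Omega> (\<lambda>_. 1) (fam i) (fam j))\<^sup>2) summable_on (I \<times> I)"

definition div_free :: "'a::euclidean_space set \<Rightarrow> ('a \<Rightarrow> 'a) \<Rightarrow> bool" where
  "div_free \<Omega> v \<longleftrightarrow> (\<forall>\<phi> D\<phi>. test_fun \<Omega> \<phi> D\<phi> \<longrightarrow>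
     integral\<^sup>L (lebesgue_on \<Omega>) (\<lambda>x. v x \<bullet> D\<phi> x) = 0)"

definition Bform :: "'a::euclidean_space set \<Rightarrow> ('a \<Rightarrow> real) \<Rightarrow> ('a \<Rightarrow> real) \<Rightarrow> ('a \<Rightarrow> real) \<Rightarrow> ('a \<Rightarrow> real) \<Rightarrow> real" where
  "Bform \<Omega> \<gamma> \<gamma>d F G = DN \<Omega> \<gamma> F G - DN \<Omega> \<gamma>d F G - DNd \<Omega> \<gamma> (\<lambda>x. \<gamma> x - \<gamma>d x) F G"

end

theory Submission
  imports Defs
begin

text \<open>
  Let \<open>z = u - v\<close> be the difference of the solutions for \<open>\<gamma>\<close> and \<open>\<gamma>d\<close> with the same boundary data \<open>F\<close>.
  As \<open>z\<close> vanishes on the boundary, it may be used as a test function in both equations, which gives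
  \<open>B(F, F) = \<integral> \<gamma>d |\<nabla>z|\<^sup>2\<close> and, for every admissible \<open>w\<close>, \<open>\<integral> X \<bullet> Y = - \<integral> |Y|\<^sup>2\<close>,
  where \<open>X = (\<gamma> - \<gamma>d) / sqrt \<gamma>d \<nabla>u - w\<close> and \<open>Y = sqrt \<gamma>d \<nabla>z\<close>.
  Part (i) is then \<open>0 \<le> \<integral> |X + Y|\<^sup>2\<close>. Parts (ii) and (iii) are the choices \<open>w = c / sqrt \<gamma>d \<nabla>h\<close>,
  where \<open>h\<close> is the solution for the conductivity \<open>c\<close> with data \<open>G\<close>, and \<open>c = \<gamma>d\<close> or \<open>c = \<gamma>\<close>.

  As gradients and solutions are picked by Hilbert choice, the argument rests on the almost everywhere
  uniqueness of weak gradients (indicators of open sets are bounded pointwise limits of test functions)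
  and on the existence of solutions (a minimising sequence of the energy among test functions is
  Cauchy by the parallelogram identity and the Poincare inequality).
\<close>

section \<open>Bounded and elliptic weights\<close>

definition Linf_on :: "'a::euclidean_space set \<Rightarrow> ('a \<Rightarrow> real) \<Rightarrow> bool" where
  "Linf_on \<Omega> a \<longleftrightarrow> a \<in> borel_measurable (lebesgue_on \<Omega>) \<and> (\<exists>C. AE x in lebesgue_on \<Omega>. \<bar>a x\<bar> \<le> C)"

definition elliptic_on :: "'a::euclidean_space set \<Rightarrow> ('a \<Rightarrow> real) \<Rightarrow> bool" where
  "elliptic_on \<Omega> a \<longleftrightarrow> Linf_on \<Omega> a \<and> (\<exists>c>0. AE x in lebesgue_on \<Omega>. c \<le> a x)"

lemma Linf_on_measurable: "Linf_on \<Omega> a \<Longrightarrow> a \<in> borel_measurable (lebesgue_on \<Omega>)"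
  by (simp add: Linf_on_def)

lemma Linf_on_const: "Linf_on \<Omega> (\<lambda>x. c)"
  by (auto simp: Linf_on_def)

lemma Linf_on_mult:
  assumes "Linf_on \<Omega> a" "Linf_on \<Omega> b"
  shows "Linf_on \<Omega> (\<lambda>x. a x * b x)"
proof -
  obtain C D where "AE x in lebesgue_on \<Omega>. \<bar>a x\<bar> \<le> C" "AE x in lebesgue_on \<Omega>. \<bar>b x\<bar> \<le> D"
    using assms by (auto simp: Linf_on_def)
  then have "AE x in lebesgue_on \<Omega>. \<bar>a x * b x\<bar> \<le> \<bar>C\<bar> * \<bar>D\<bar>"
    by eventually_elim (auto simp: abs_mult intro!: mult_mono)
  then show ?thesis
    using assms by (auto simp: Linf_on_def)
qed

lemma Linf_on_diff:
  assumes "Linf_on \<Omega> a" "Linf_on \<Omega> b"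
  shows "Linf_on \<Omega> (\<lambda>x. a x - b x)"
proof -
  obtain C D where "AE x in lebesgue_on \<Omega>. \<bar>a x\<bar> \<le> C" "AE x in lebesgue_on \<Omega>. \<bar>b x\<bar> \<le> D"
    using assms by (auto simp: Linf_on_def)
  then have "AE x in lebesgue_on \<Omega>. \<bar>a x - b x\<bar> \<le> C + D"
    by eventually_elim auto
  then show ?thesis
    using assms by (auto simp: Linf_on_def)
qed

lemma Linf_on_sqrt:
  assumes "Linf_on \<Omega> a"
  shows "Linf_on \<Omega> (\<lambda>x. sqrt (a x))"
proof -
  obtain C where "AE x in lebesgue_on \<Omega>. \<bar>a x\<bar> \<le> C"
    using assms by (auto simp: Linf_on_def)
  then have "AE x in lebesgue_on \<Omega>. \<bar>sqrt (a x)\<bar> \<le> sqrt C"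
    by eventually_elim (simp flip: real_sqrt_abs2 add: real_sqrt_abs')
  then show ?thesis
    using assms by (auto simp: Linf_on_def)
qed

lemma elliptic_on_imp_Linf_on: "elliptic_on \<Omega> a \<Longrightarrow> Linf_on \<Omega> a"
  by (simp add: elliptic_on_def)

lemma elliptic_on_AE_pos: "elliptic_on \<Omega> a \<Longrightarrow> AE x in lebesgue_on \<Omega>. 0 < a x"
  by (auto simp: elliptic_on_def elim!: eventually_mono)

lemma elliptic_on_sqrt:
  assumes "elliptic_on \<Omega> a"
  shows "elliptic_on \<Omega> (\<lambda>x. sqrt (a x))"
proof -
  obtain c where "c > 0" and a_ge: "AE x in lebesgue_on \<Omega>. c \<le> a x"
    using assms by (auto simp: elliptic_on_def)
  from a_ge have "AE x in lebesgue_on \<Omega>. sqrt c \<le> sqrt (a x)"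
    by eventually_elim simp
  with \<open>c > 0\<close> have "\<exists>c>0. AE x in lebesgue_on \<Omega>. c \<le> sqrt (a x)"
    by (intro exI[of _ "sqrt c"]) simp
  then show ?thesis
    using assms by (simp add: elliptic_on_def Linf_on_sqrt)
qed

lemma Linf_on_divide:
  assumes "Linf_on \<Omega> b" "elliptic_on \<Omega> a"
  shows "Linf_on \<Omega> (\<lambda>x. b x / a x)"
proof -
  obtain c where "c > 0" and a_ge: "AE x in lebesgue_on \<Omega>. c \<le> a x"
    using assms(2) by (auto simp: elliptic_on_def)
  from a_ge have "AE x in lebesgue_on \<Omega>. \<bar>inverse (a x)\<bar> \<le> inverse c"
    by eventually_elim (use \<open>c > 0\<close> in \<open>simp add: le_imp_inverse_le\<close>)
  then have "Linf_on \<Omega> (\<lambda>x. inverse (a x))"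
    using Linf_on_measurable[OF elliptic_on_imp_Linf_on[OF assms(2)]] by (auto simp: Linf_on_def)
  from Linf_on_mult[OF assms(1) this] show ?thesis
    by (simp add: divide_inverse)
qed

lemma conductivity_imp_elliptic_on:
  assumes "conductivity \<Omega> lo hi a" "0 < lo"
  shows "elliptic_on \<Omega> a"
proof -
  have "AE x in lebesgue_on \<Omega>. lo \<le> a x \<and> a x \<le> hi"
    using assms(1) by (simp add: conductivity_def)
  then have "AE x in lebesgue_on \<Omega>. \<bar>a x\<bar> \<le> hi \<and> lo \<le> a x"
    by eventually_elim (use assms(2) in auto)
  then show ?thesis
    using assms by (auto simp: elliptic_on_def Linf_on_def conductivity_def)
qed

section \<open>Square-integrable functions\<close>

definition L2_norm_on :: "'a::euclidean_space set \<Rightarrow> ('a \<Rightarrow> 'b::real_normed_vector) \<Rightarrow> real" where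
  "L2_norm_on \<Omega> f = sqrt (\<integral>x. (norm (f x))\<^sup>2 \<partial>lebesgue_on \<Omega>)"

lemma L2_norm_on_nonneg: "0 \<le> L2_norm_on \<Omega> f"
  by (simp add: L2_norm_on_def)

lemma L2_norm_on_power2: "(L2_norm_on \<Omega> f)\<^sup>2 = (\<integral>x. (norm (f x))\<^sup>2 \<partial>lebesgue_on \<Omega>)"
  by (simp add: L2_norm_on_def)

lemma L2_norm_on_minus_commute: "L2_norm_on \<Omega> (\<lambda>x. f x - g x) = L2_norm_on \<Omega> (\<lambda>x. g x - f x)"
  by (simp add: L2_norm_on_def norm_minus_commute)

lemma L2_on_measurable: "L2_on \<Omega> f \<Longrightarrow> f \<in> borel_measurable (lebesgue_on \<Omega>)"
  by (simp add: L2_on_def)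

lemma L2_on_power2_norm_integrable: "L2_on \<Omega> f \<Longrightarrow> integrable (lebesgue_on \<Omega>) (\<lambda>x. (norm (f x))\<^sup>2)"
  by (simp add: L2_on_def)

lemma L2_on_zero: "L2_on \<Omega> (\<lambda>x. 0)"
  by (simp add: L2_on_def)

lemma L2_on_dominated:
  fixes f :: "'a::euclidean_space \<Rightarrow> 'b::real_normed_vector" and g :: "'a \<Rightarrow> 'c::real_normed_vector"
  assumes f_meas: "f \<in> borel_measurable (lebesgue_on \<Omega>)" and g_L2: "L2_on \<Omega> g" and "0 \<le> C"
    and f_le: "AE x in lebesgue_on \<Omega>. norm (f x) \<le> C * norm (g x)"
  shows "L2_on \<Omega> f" "L2_norm_on \<Omega> f \<le> C * L2_norm_on \<Omega> g"
proof -
  have g_int: "integrable (lebesgue_on \<Omega>) (\<lambda>x. C\<^sup>2 * (norm (g x))\<^sup>2)"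
    using g_L2 by (simp add: L2_on_def)
  have f_le_power2: "AE x in lebesgue_on \<Omega>. (norm (f x))\<^sup>2 \<le> C\<^sup>2 * (norm (g x))\<^sup>2"
    using f_le by eventually_elim (simp add: power_mono flip: power_mult_distrib)
  have f_int: "integrable (lebesgue_on \<Omega>) (\<lambda>x. (norm (f x))\<^sup>2)"
    by (rule Bochner_Integration.integrable_bound[OF g_int]) (use f_meas f_le_power2 in auto)
  with f_meas show "L2_on \<Omega> f"
    by (simp add: L2_on_def)
  have "(L2_norm_on \<Omega> f)\<^sup>2 \<le> (C * L2_norm_on \<Omega> g)\<^sup>2"
    using integral_mono_AE[OF f_int g_int f_le_power2]
    by (simp add: L2_norm_on_power2 power_mult_distrib)
  then show "L2_norm_on \<Omega> f \<le> C * L2_norm_on \<Omega> g"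
    by (rule power2_le_imp_le) (simp add: \<open>0 \<le> C\<close> L2_norm_on_nonneg)
qed

lemma L2_on_scaleR_AE_bounded:
  fixes f :: "'a::euclidean_space \<Rightarrow> 'b::{banach, second_countable_topology}"
  assumes a_meas: "a \<in> borel_measurable (lebesgue_on \<Omega>)"
    and a_bounded: "AE x in lebesgue_on \<Omega>. \<bar>a x\<bar> \<le> C" and f_L2: "L2_on \<Omega> f"
  shows "L2_on \<Omega> (\<lambda>x. a x *\<^sub>R f x)" "L2_norm_on \<Omega> (\<lambda>x. a x *\<^sub>R f x) \<le> \<bar>C\<bar> * L2_norm_on \<Omega> f"
proof -
  have af_meas: "(\<lambda>x. a x *\<^sub>R f x) \<in> borel_measurable (lebesgue_on \<Omega>)"
    using a_meas L2_on_measurable[OF f_L2] by (rule borel_measurable_scaleR)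
  have af_le: "AE x in lebesgue_on \<Omega>. norm (a x *\<^sub>R f x) \<le> \<bar>C\<bar> * norm (f x)"
    using a_bounded by eventually_elim (simp add: mult_right_mono)
  show "L2_on \<Omega> (\<lambda>x. a x *\<^sub>R f x)" "L2_norm_on \<Omega> (\<lambda>x. a x *\<^sub>R f x) \<le> \<bar>C\<bar> * L2_norm_on \<Omega> f"
    by (rule L2_on_dominated[OF af_meas f_L2 abs_ge_zero af_le])+
qed

lemma L2_on_scaleR_Linf:
  fixes f :: "'a::euclidean_space \<Rightarrow> 'b::{banach, second_countable_topology}"
  assumes "Linf_on \<Omega> a" "L2_on \<Omega> f"
  shows "L2_on \<Omega> (\<lambda>x. a x *\<^sub>R f x)"
  using assms L2_on_scaleR_AE_bounded(1) by (auto simp: Linf_on_def)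

lemma L2_on_scaleR:
  fixes f :: "'a::euclidean_space \<Rightarrow> 'b::{banach, second_countable_topology}"
  shows "L2_on \<Omega> f \<Longrightarrow> L2_on \<Omega> (\<lambda>x. c *\<^sub>R f x)"
  by (rule L2_on_scaleR_Linf[OF Linf_on_const])

lemma L2_on_add:
  fixes f g :: "'a::euclidean_space \<Rightarrow> 'b::{banach, second_countable_topology}"
  assumes "L2_on \<Omega> f" "L2_on \<Omega> g"
  shows "L2_on \<Omega> (\<lambda>x. f x + g x)"
proof -
  have [measurable]: "f \<in> borel_measurable (lebesgue_on \<Omega>)" "g \<in> borel_measurable (lebesgue_on \<Omega>)"
    using assms by (auto intro: L2_on_measurable)
  have "integrable (lebesgue_on \<Omega>) (\<lambda>x. (norm (f x + g x))\<^sup>2)"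
  proof (rule Bochner_Integration.integrable_bound)
    show "integrable (lebesgue_on \<Omega>) (\<lambda>x. 2 * (norm (f x))\<^sup>2 + 2 * (norm (g x))\<^sup>2)"
      using assms by (simp add: L2_on_def)
    have "(norm (u + v))\<^sup>2 \<le> 2 * (norm u)\<^sup>2 + 2 * (norm v)\<^sup>2" for u v :: 'b
    proof -
      have "(norm (u + v))\<^sup>2 \<le> (norm u + norm v)\<^sup>2"
        by (intro power_mono norm_triangle_ineq norm_ge_zero)
      then show ?thesis
        using sum_squares_bound[of "norm u" "norm v"] by (simp add: power2_sum)
    qed
    then show "AE x in lebesgue_on \<Omega>. norm ((norm (f x + g x))\<^sup>2)
        \<le> norm (2 * (norm (f x))\<^sup>2 + 2 * (norm (g x))\<^sup>2)"
      by simp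
  qed measurable
  then show ?thesis
    by (simp add: L2_on_def)
qed

lemma L2_on_diff:
  fixes f g :: "'a::euclidean_space \<Rightarrow> 'b::{banach, second_countable_topology}"
  assumes "L2_on \<Omega> f" "L2_on \<Omega> g"
  shows "L2_on \<Omega> (\<lambda>x. f x - g x)"
  using L2_on_add[OF assms(1) L2_on_scaleR[OF assms(2), of "-1"]] by simp

lemma L2_on_norm_mult_integrable:
  fixes f :: "'a::euclidean_space \<Rightarrow> 'b::real_normed_vector" and g :: "'a \<Rightarrow> 'c::real_normed_vector"
  assumes "L2_on \<Omega> f" "L2_on \<Omega> g"
  shows "integrable (lebesgue_on \<Omega>) (\<lambda>x. norm (f x) * norm (g x))"
proof (rule Bochner_Integration.integrable_bound)
  show "integrable (lebesgue_on \<Omega>) (\<lambda>x. (norm (f x))\<^sup>2 + (norm (g x))\<^sup>2)"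
    using assms by (simp add: L2_on_def)
  have "\<bar>s * t\<bar> \<le> s\<^sup>2 + t\<^sup>2" if "0 \<le> s" "0 \<le> t" for s t :: real
    using sum_squares_bound[of s t] mult_nonneg_nonneg[OF that] by simp
  then show "AE x in lebesgue_on \<Omega>. norm (norm (f x) * norm (g x))
      \<le> norm ((norm (f x))\<^sup>2 + (norm (g x))\<^sup>2)"
    by simp
qed (use assms in \<open>auto simp: L2_on_def\<close>)

lemma L2_Cauchy_Schwarz:
  fixes f :: "'a::euclidean_space \<Rightarrow> 'b::real_normed_vector" and g :: "'a \<Rightarrow> 'c::real_normed_vector"
  assumes "L2_on \<Omega> f" "L2_on \<Omega> g"
  shows "(\<integral>x. norm (f x) * norm (g x) \<partial>lebesgue_on \<Omega>) \<le> L2_norm_on \<Omega> f * L2_norm_on \<Omega> g"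
proof -
  let ?M = "lebesgue_on \<Omega>"
  have norm_sq: "(\<integral>\<^sup>+x. (ennreal (norm (h x)))\<^sup>2 \<partial>?M) = ennreal ((L2_norm_on \<Omega> h)\<^sup>2)"
    if "L2_on \<Omega> h" for h :: "'a \<Rightarrow> 'd::real_normed_vector"
    using that by (simp add: L2_norm_on_power2 ennreal_power L2_on_def nn_integral_eq_integral)
  have "(\<integral>\<^sup>+x. ennreal (norm (f x)) * ennreal (norm (g x)) \<partial>?M)\<^sup>2
      \<le> (\<integral>\<^sup>+x. (ennreal (norm (f x)))\<^sup>2 \<partial>?M) * (\<integral>\<^sup>+x. (ennreal (norm (g x)))\<^sup>2 \<partial>?M)"
    using assms by (intro Cauchy_Schwarz_nn_integral) (auto dest: L2_on_measurable)
  moreover have "(\<integral>\<^sup>+x. ennreal (norm (f x)) * ennreal (norm (g x)) \<partial>?M)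
      = ennreal (\<integral>x. norm (f x) * norm (g x) \<partial>?M)"
    using nn_integral_eq_integral[OF L2_on_norm_mult_integrable[OF assms]] by (simp add: ennreal_mult)
  ultimately have "(\<integral>x. norm (f x) * norm (g x) \<partial>?M)\<^sup>2 \<le> (L2_norm_on \<Omega> f * L2_norm_on \<Omega> g)\<^sup>2"
    unfolding norm_sq[OF assms(1)] norm_sq[OF assms(2)]
    by (simp add: ennreal_power power_mult_distrib flip: ennreal_mult)
  then show ?thesis
    by (rule power2_le_imp_le) (simp add: L2_norm_on_nonneg)
qed

lemma L2_norm_on_triangle:
  fixes f g :: "'a::euclidean_space \<Rightarrow> 'b::{banach, second_countable_topology}"
  assumes "L2_on \<Omega> f" "L2_on \<Omega> g"
  shows "L2_norm_on \<Omega> (\<lambda>x. f x + g x) \<le> L2_norm_on \<Omega> f + L2_norm_on \<Omega> g"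
proof (rule power2_le_imp_le)
  let ?M = "lebesgue_on \<Omega>"
  note integrable = L2_on_power2_norm_integrable[OF assms(1)] L2_on_power2_norm_integrable[OF assms(2)]
    L2_on_norm_mult_integrable[OF assms]
  have "(L2_norm_on \<Omega> (\<lambda>x. f x + g x))\<^sup>2
      \<le> (\<integral>x. (norm (f x))\<^sup>2 + 2 * (norm (f x) * norm (g x)) + (norm (g x))\<^sup>2 \<partial>?M)"
    unfolding L2_norm_on_power2
  proof (rule integral_mono)
    show "(norm (f x + g x))\<^sup>2 \<le> (norm (f x))\<^sup>2 + 2 * (norm (f x) * norm (g x)) + (norm (g x))\<^sup>2" for x
      using power_mono[OF norm_triangle_ineq[of "f x" "g x"], of 2] by (simp add: power2_sum)
  qed (use integrable L2_on_power2_norm_integrable[OF L2_on_add[OF assms]] in auto)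
  also have "\<dots> = (L2_norm_on \<Omega> f)\<^sup>2 + 2 * (\<integral>x. norm (f x) * norm (g x) \<partial>?M) + (L2_norm_on \<Omega> g)\<^sup>2"
    using integrable by (simp add: L2_norm_on_power2)
  also have "\<dots> \<le> (L2_norm_on \<Omega> f + L2_norm_on \<Omega> g)\<^sup>2"
    using L2_Cauchy_Schwarz[OF assms] by (simp add: power2_sum)
  finally show "(L2_norm_on \<Omega> (\<lambda>x. f x + g x))\<^sup>2 \<le> (L2_norm_on \<Omega> f + L2_norm_on \<Omega> g)\<^sup>2" .
qed (simp add: L2_norm_on_nonneg)

lemma L2_bounded_bilinear_integrable:
  fixes f :: "'a::euclidean_space \<Rightarrow> 'b::{banach, second_countable_topology}"
    and g :: "'a \<Rightarrow> 'c::{banach, second_countable_topology}"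
    and B :: "'b \<Rightarrow> 'c \<Rightarrow> 'd::{banach, second_countable_topology}"
  assumes "bounded_bilinear B" "L2_on \<Omega> f" "L2_on \<Omega> g"
  shows "integrable (lebesgue_on \<Omega>) (\<lambda>x. B (f x) (g x))"
proof -
  obtain K where B_bounded: "\<And>u v. norm (B u v) \<le> norm u * norm v * K"
    using bounded_bilinear.bounded[OF assms(1)] by blast
  have [measurable]: "f \<in> borel_measurable (lebesgue_on \<Omega>)" "g \<in> borel_measurable (lebesgue_on \<Omega>)"
    using assms by (auto intro: L2_on_measurable)
  have "continuous_on UNIV (\<lambda>p. B (fst p) (snd p))"
    by (intro bounded_bilinear.continuous_on[OF assms(1)] continuous_intros)
  then have [measurable]: "(\<lambda>x. B (f x) (g x)) \<in> borel_measurable (lebesgue_on \<Omega>)"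
    by (rule borel_measurable_continuous_Pair[rotated 2]) measurable
  show ?thesis
  proof (rule Bochner_Integration.integrable_bound)
    show "integrable (lebesgue_on \<Omega>) (\<lambda>x. norm (f x) * norm (g x) * K)"
      by (intro integrable_mult_left L2_on_norm_mult_integrable assms)
    show "AE x in lebesgue_on \<Omega>. norm (B (f x) (g x)) \<le> norm (norm (f x) * norm (g x) * K)"
      by (intro always_eventually allI) (simp add: order_trans[OF B_bounded abs_ge_self])
  qed measurable
qed

lemmas L2_on_scaleR_integrable = L2_bounded_bilinear_integrable[OF bounded_bilinear_scaleR]

lemma L2_norm_integral_bounded_bilinear_le:
  fixes B :: "'b::{banach, second_countable_topology} \<Rightarrow> 'c::{banach, second_countable_topology}
    \<Rightarrow> 'd::{banach, second_countable_topology}"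
  assumes "bounded_bilinear B"
  obtains K where "K \<ge> 0"
    "\<And>f g. L2_on \<Omega> f \<Longrightarrow> L2_on \<Omega> g \<Longrightarrow>
      norm (\<integral>x. B (f x) (g x) \<partial>lebesgue_on \<Omega>) \<le> K * (L2_norm_on \<Omega> f * L2_norm_on \<Omega> g)"
proof -
  obtain K where B_bounded: "K \<ge> 0" "\<And>u v. norm (B u v) \<le> norm u * norm v * K"
    using bounded_bilinear.nonneg_bounded[OF assms] by blast
  have "norm (\<integral>x. B (f x) (g x) \<partial>lebesgue_on \<Omega>) \<le> K * (L2_norm_on \<Omega> f * L2_norm_on \<Omega> g)"
    if "L2_on \<Omega> f" "L2_on \<Omega> g" for f g
  proof -
    have "norm (\<integral>x. B (f x) (g x) \<partial>lebesgue_on \<Omega>) \<le> (\<integral>x. norm (B (f x) (g x)) \<partial>lebesgue_on \<Omega>)"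
      by (rule integral_norm_bound)
    also have "\<dots> \<le> (\<integral>x. norm (f x) * norm (g x) * K \<partial>lebesgue_on \<Omega>)"
      by (intro integral_mono integrable_norm integrable_mult_left L2_on_norm_mult_integrable
          L2_bounded_bilinear_integrable assms B_bounded that)
    also have "\<dots> \<le> K * (L2_norm_on \<Omega> f * L2_norm_on \<Omega> g)"
      using mult_left_mono[OF L2_Cauchy_Schwarz[OF that] B_bounded(1)] by (simp add: mult.commute)
    finally show ?thesis .
  qed
  with B_bounded(1) show ?thesis
    by (rule that)
qed

section \<open>Convergence in the mean square\<close>

definition L2_tendsto ::
  "'a::euclidean_space set \<Rightarrow> (nat \<Rightarrow> 'a \<Rightarrow> 'b::real_normed_vector) \<Rightarrow> ('a \<Rightarrow> 'b) \<Rightarrow> bool" where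
  "L2_tendsto \<Omega> f F \<longleftrightarrow> (\<forall>k. L2_on \<Omega> (f k)) \<and> L2_on \<Omega> F \<and> (\<lambda>k. L2_norm_on \<Omega> (\<lambda>x. f k x - F x)) \<longlonglongrightarrow> 0"

definition L2_Cauchy :: "'a::euclidean_space set \<Rightarrow> (nat \<Rightarrow> 'a \<Rightarrow> 'b::real_normed_vector) \<Rightarrow> bool" where
  "L2_Cauchy \<Omega> f \<longleftrightarrow> (\<forall>k. L2_on \<Omega> (f k)) \<and>
     (\<forall>e>0. \<exists>N. \<forall>m\<ge>N. \<forall>n\<ge>N. L2_norm_on \<Omega> (\<lambda>x. f m x - f n x) < e)"

lemma L2_tendsto_imp_L2_on:
  assumes "L2_tendsto \<Omega> f F"
  shows "L2_on \<Omega> (f k)" "L2_on \<Omega> F"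
  using assms by (auto simp: L2_tendsto_def)

lemma L2_tendsto_const: "L2_on \<Omega> F \<Longrightarrow> L2_tendsto \<Omega> (\<lambda>k. F) F"
  by (simp add: L2_tendsto_def L2_norm_on_def)

lemma L2_tendsto_power2:
  assumes "\<And>k. L2_on \<Omega> (f k)" "L2_on \<Omega> F"
  shows "L2_tendsto \<Omega> f F \<longleftrightarrow> (\<lambda>k. \<integral>x. (norm (F x - f k x))\<^sup>2 \<partial>lebesgue_on \<Omega>) \<longlonglongrightarrow> 0"
proof -
  have "(\<lambda>k. L2_norm_on \<Omega> (\<lambda>x. f k x - F x)) \<longlonglongrightarrow> 0 \<longleftrightarrow> (\<lambda>k. (L2_norm_on \<Omega> (\<lambda>x. F x - f k x))\<^sup>2) \<longlonglongrightarrow> 0"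
    by (simp add: L2_norm_on_minus_commute)
  then show ?thesis
    using assms by (simp add: L2_tendsto_def L2_norm_on_power2)
qed

lemma L2_tendsto_add:
  fixes f g :: "nat \<Rightarrow> 'a::euclidean_space \<Rightarrow> 'b::{banach, second_countable_topology}"
  assumes "L2_tendsto \<Omega> f F" "L2_tendsto \<Omega> g G"
  shows "L2_tendsto \<Omega> (\<lambda>k x. f k x + g k x) (\<lambda>x. F x + G x)"
proof -
  note fg_L2 = L2_tendsto_imp_L2_on[OF assms(1)] L2_tendsto_imp_L2_on[OF assms(2)]
  have "(\<lambda>k. L2_norm_on \<Omega> (\<lambda>x. (f k x + g k x) - (F x + G x))) \<longlonglongrightarrow> 0"
  proof (rule tendsto_sandwich[OF _ _ tendsto_const])
    show "(\<lambda>k. L2_norm_on \<Omega> (\<lambda>x. f k x - F x) + L2_norm_on \<Omega> (\<lambda>x. g k x - G x)) \<longlonglongrightarrow> 0"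
      using assms by (auto simp: L2_tendsto_def intro: tendsto_add_zero)
    have "L2_norm_on \<Omega> (\<lambda>x. (f k x + g k x) - (F x + G x))
        \<le> L2_norm_on \<Omega> (\<lambda>x. f k x - F x) + L2_norm_on \<Omega> (\<lambda>x. g k x - G x)" for k
      using L2_norm_on_triangle[OF L2_on_diff[OF fg_L2(1,2)] L2_on_diff[OF fg_L2(3,4)]]
      by (simp add: add_diff_add)
    then show "\<forall>\<^sub>F k in sequentially. L2_norm_on \<Omega> (\<lambda>x. (f k x + g k x) - (F x + G x))
        \<le> L2_norm_on \<Omega> (\<lambda>x. f k x - F x) + L2_norm_on \<Omega> (\<lambda>x. g k x - G x)"
      by simp
  qed (simp add: L2_norm_on_nonneg)
  then show ?thesis
    using fg_L2 by (simp add: L2_tendsto_def L2_on_add)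
qed

lemma L2_tendsto_scaleR_Linf:
  fixes f :: "nat \<Rightarrow> 'a::euclidean_space \<Rightarrow> 'b::{banach, second_countable_topology}"
  assumes a_Linf: "Linf_on \<Omega> a" and f_lim: "L2_tendsto \<Omega> f F"
  shows "L2_tendsto \<Omega> (\<lambda>k x. a x *\<^sub>R f k x) (\<lambda>x. a x *\<^sub>R F x)"
proof -
  note f_L2 = L2_tendsto_imp_L2_on[OF f_lim]
  obtain C where a_bounded: "AE x in lebesgue_on \<Omega>. \<bar>a x\<bar> \<le> C"
    using a_Linf by (auto simp: Linf_on_def)
  have "(\<lambda>k. L2_norm_on \<Omega> (\<lambda>x. a x *\<^sub>R f k x - a x *\<^sub>R F x)) \<longlonglongrightarrow> 0"
  proof (rule Lim_null_comparison)
    show "(\<lambda>k. \<bar>C\<bar> * L2_norm_on \<Omega> (\<lambda>x. f k x - F x)) \<longlonglongrightarrow> 0"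
      using f_lim by (simp add: L2_tendsto_def tendsto_mult_right_zero)
    show "\<forall>\<^sub>F k in sequentially. norm (L2_norm_on \<Omega> (\<lambda>x. a x *\<^sub>R f k x - a x *\<^sub>R F x))
        \<le> \<bar>C\<bar> * L2_norm_on \<Omega> (\<lambda>x. f k x - F x)"
      using L2_on_scaleR_AE_bounded(2)[OF Linf_on_measurable[OF a_Linf] a_bounded L2_on_diff[OF f_L2]]
      by (simp add: L2_norm_on_nonneg flip: scaleR_diff_right)
  qed
  then show ?thesis
    using f_L2 a_Linf by (simp add: L2_tendsto_def L2_on_scaleR_Linf)
qed

lemma L2_tendsto_diff:
  fixes f g :: "nat \<Rightarrow> 'a::euclidean_space \<Rightarrow> 'b::{banach, second_countable_topology}"
  assumes "L2_tendsto \<Omega> f F" "L2_tendsto \<Omega> g G"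
  shows "L2_tendsto \<Omega> (\<lambda>k x. f k x - g k x) (\<lambda>x. F x - G x)"
  using L2_tendsto_add[OF assms(1) L2_tendsto_scaleR_Linf[OF Linf_on_const assms(2), of "-1"]] by simp

lemma L2_tendsto_integral_bounded_bilinear:
  fixes B :: "'b::{banach, second_countable_topology} \<Rightarrow> 'c::{banach, second_countable_topology}
    \<Rightarrow> 'd::{banach, second_countable_topology}"
  assumes bilinear_B: "bounded_bilinear B" and f_lim: "L2_tendsto \<Omega> f F" and g_lim: "L2_tendsto \<Omega> g G"
  shows "(\<lambda>k. \<integral>x. B (f k x) (g k x) \<partial>lebesgue_on \<Omega>) \<longlonglongrightarrow> (\<integral>x. B (F x) (G x) \<partial>lebesgue_on \<Omega>)"
proof -
  interpret bounded_bilinear B by (rule bilinear_B)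
  define I where "I u v = (\<integral>x. B (u x) (v x) \<partial>lebesgue_on \<Omega>)" for u v
  define d where "d k x = f k x - F x" for k x
  define e where "e k x = g k x - G x" for k x
  obtain K where I_bounded: "K \<ge> 0"
    "\<And>u v. L2_on \<Omega> u \<Longrightarrow> L2_on \<Omega> v \<Longrightarrow> norm (I u v) \<le> K * (L2_norm_on \<Omega> u * L2_norm_on \<Omega> v)"
    unfolding I_def using L2_norm_integral_bounded_bilinear_le[OF bilinear_B] by blast
  note fg_L2 = L2_tendsto_imp_L2_on[OF f_lim] L2_tendsto_imp_L2_on[OF g_lim]
  have error_L2: "L2_on \<Omega> (d k)" "L2_on \<Omega> (e k)" for k
    unfolding d_def e_def by (intro L2_on_diff fg_L2)+
  have error_lim: "(\<lambda>k. L2_norm_on \<Omega> (d k)) \<longlonglongrightarrow> 0" "(\<lambda>k. L2_norm_on \<Omega> (e k)) \<longlonglongrightarrow> 0"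
    using f_lim g_lim by (auto simp: L2_tendsto_def d_def[abs_def] e_def[abs_def])
  have I_expand: "I (f k) (g k) - I F G = I (d k) (e k) + I (d k) G + I F (e k)" for k
  proof -
    have "B (f k x) (g k x)
        = B (F x) (G x) + B (d k x) (e k x) + B (d k x) (G x) + B (F x) (e k x)" for x
      by (simp add: d_def e_def diff_left diff_right)
    then show ?thesis
      using fg_L2 error_L2 by (simp add: I_def L2_bounded_bilinear_integrable[OF bilinear_B])
  qed
  have "(\<lambda>k. I (f k) (g k) - I F G) \<longlonglongrightarrow> 0"
  proof (rule Lim_null_comparison)
    let ?bound = "\<lambda>k. K * (L2_norm_on \<Omega> (d k) * L2_norm_on \<Omega> (e k))
        + K * (L2_norm_on \<Omega> (d k) * L2_norm_on \<Omega> G)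
        + K * (L2_norm_on \<Omega> F * L2_norm_on \<Omega> (e k))"
    show "?bound \<longlonglongrightarrow> 0"
      using error_lim by (auto intro!: tendsto_eq_intros)
    show "\<forall>\<^sub>F k in sequentially. norm (I (f k) (g k) - I F G) \<le> ?bound k"
      unfolding I_expand
      by (intro always_eventually allI norm_triangle_le add_mono I_bounded error_L2 fg_L2)
  qed
  then show ?thesis
    unfolding I_def by (rule LIM_zero_cancel)
qed

lemma L2_Cauchy_imp_L2_on: "L2_Cauchy \<Omega> f \<Longrightarrow> L2_on \<Omega> (f k)"
  by (simp add: L2_Cauchy_def)

lemma L2_CauchyE:
  assumes "L2_Cauchy \<Omega> f" "e > 0"
  obtains N where "\<And>m n. m \<ge> N \<Longrightarrow> n \<ge> N \<Longrightarrow> L2_norm_on \<Omega> (\<lambda>x. f m x - f n x) < e"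
  using assms unfolding L2_Cauchy_def by metis

lemma L2_Cauchy_dominated:
  assumes g_Cauchy: "L2_Cauchy \<Omega> g" and f_L2: "\<And>k. L2_on \<Omega> (f k)"
    and f_le_g: "\<And>m n. L2_norm_on \<Omega> (\<lambda>x. f m x - f n x) \<le> C * L2_norm_on \<Omega> (\<lambda>x. g m x - g n x)"
  shows "L2_Cauchy \<Omega> f"
  unfolding L2_Cauchy_def
proof (intro conjI allI impI f_L2)
  fix e :: real assume "e > 0"
  then have "e / (\<bar>C\<bar> + 1) > 0"
    by simp
  then obtain N where g_close: "\<And>m n. m \<ge> N \<Longrightarrow> n \<ge> N \<Longrightarrow> L2_norm_on \<Omega> (\<lambda>x. g m x - g n x) < e / (\<bar>C\<bar> + 1)"
    using L2_CauchyE[OF g_Cauchy] by blast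
  have "L2_norm_on \<Omega> (\<lambda>x. f m x - f n x) < e" if "m \<ge> N" "n \<ge> N" for m n
  proof -
    have "L2_norm_on \<Omega> (\<lambda>x. f m x - f n x) \<le> (\<bar>C\<bar> + 1) * L2_norm_on \<Omega> (\<lambda>x. g m x - g n x)"
      by (rule order_trans[OF f_le_g]) (simp add: mult_right_mono L2_norm_on_nonneg)
    also have "\<dots> < e"
      using g_close[OF that] by (simp add: pos_less_divide_eq mult.commute)
    finally show ?thesis .
  qed
  then show "\<exists>N. \<forall>m\<ge>N. \<forall>n\<ge>N. L2_norm_on \<Omega> (\<lambda>x. f m x - f n x) < e"
    by blast
qed

lemma L2_tendsto_imp_L2_Cauchy:
  fixes f :: "nat \<Rightarrow> 'a::euclidean_space \<Rightarrow> 'b::{banach, second_countable_topology}"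
  assumes "L2_tendsto \<Omega> f F"
  shows "L2_Cauchy \<Omega> f"
  unfolding L2_Cauchy_def
proof (intro conjI allI impI L2_tendsto_imp_L2_on(1)[OF assms])
  fix e :: real assume "e > 0"
  have "(\<lambda>k. L2_norm_on \<Omega> (\<lambda>x. f k x - F x)) \<longlonglongrightarrow> 0"
    using assms by (simp add: L2_tendsto_def)
  from LIMSEQ_D[OF this, of "e / 2"] \<open>e > 0\<close>
  obtain N where f_close: "\<And>k. k \<ge> N \<Longrightarrow> L2_norm_on \<Omega> (\<lambda>x. f k x - F x) < e / 2"
    by (auto simp: L2_norm_on_nonneg)
  have "L2_norm_on \<Omega> (\<lambda>x. f m x - f n x) < e" if "m \<ge> N" "n \<ge> N" for m n
  proof -
    have "L2_norm_on \<Omega> (\<lambda>x. f m x - f n x) = L2_norm_on \<Omega> (\<lambda>x. (f m x - F x) + (F x - f n x))"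
      by simp
    also have "\<dots> \<le> L2_norm_on \<Omega> (\<lambda>x. f m x - F x) + L2_norm_on \<Omega> (\<lambda>x. F x - f n x)"
      by (intro L2_norm_on_triangle L2_on_diff L2_tendsto_imp_L2_on[OF assms])
    also have "\<dots> < e"
      using f_close[OF that(1)] f_close[OF that(2)] by (simp add: L2_norm_on_minus_commute[of \<Omega> F])
    finally show ?thesis .
  qed
  then show "\<exists>N. \<forall>m\<ge>N. \<forall>n\<ge>N. L2_norm_on \<Omega> (\<lambda>x. f m x - f n x) < e"
    by blast
qed

lemma sigma_finite_lebesgue_on:
  fixes \<Omega> :: "'a::euclidean_space set"
  assumes "\<Omega> \<in> sets lebesgue"
  shows "sigma_finite_measure (lebesgue_on \<Omega>)"
proof (rule sigma_finite_measure_restrict_space[OF _ assms])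
  obtain A :: "'a set set" where lborel_cover: "countable A" "A \<subseteq> sets lborel"
    "\<Union>A = space lborel" "\<forall>a\<in>A. emeasure lborel a \<noteq> \<infinity>"
    using lborel.sigma_finite_countable by blast
  then have "A \<subseteq> sets lebesgue" "\<forall>a\<in>A. emeasure lebesgue a \<noteq> \<infinity>"
    by (simp_all add: subset_iff)
  with lborel_cover(1,3) show "sigma_finite_measure (lebesgue :: 'a measure)"
    unfolding sigma_finite_measure_def by (intro exI[of _ A]) simp
qed

text \<open>Multiplying by a strictly positive square-integrable function reduces the claim to the \<open>L\<^sup>1\<close> case,
  also when \<open>\<Omega>\<close> has infinite measure.\<close>
lemma L2_Cauchy_AE_Cauchy_subseq:
  fixes f :: "nat \<Rightarrow> 'a::euclidean_space \<Rightarrow> 'b::{banach, second_countable_topology}"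
  assumes meas_\<Omega>: "\<Omega> \<in> sets lebesgue" and f_Cauchy: "L2_Cauchy \<Omega> f"
  obtains r where "strict_mono r" "AE x in lebesgue_on \<Omega>. Cauchy (\<lambda>i. f (r i) x)"
proof -
  interpret sigma_finite_measure "lebesgue_on \<Omega>"
    using meas_\<Omega> by (rule sigma_finite_lebesgue_on)
  obtain h :: "'a \<Rightarrow> real" where h_pos_int: "h \<in> borel_measurable (lebesgue_on \<Omega>)"
    "\<And>x. h x > 0" "integrable (lebesgue_on \<Omega>) h"
    using obtain_positive_integrable_function by metis
  define s where "s = (\<lambda>x. sqrt (h x))"
  have s_L2: "L2_on \<Omega> s"
    using h_pos_int by (simp add: L2_on_def s_def less_imp_le)
  note f_L2 = L2_Cauchy_imp_L2_on[OF f_Cauchy]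
  have L1_le_L2: "(\<integral>x. norm (s x *\<^sub>R f m x - s x *\<^sub>R f n x) \<partial>lebesgue_on \<Omega>)
      \<le> L2_norm_on \<Omega> s * L2_norm_on \<Omega> (\<lambda>x. f m x - f n x)" for m n
    using L2_Cauchy_Schwarz[OF s_L2 L2_on_diff[OF f_L2 f_L2], of m n] by (simp flip: scaleR_diff_right)
  have L1_Cauchy: "\<exists>N. \<forall>m\<ge>N. \<forall>n\<ge>N.
      (\<integral>x. norm (s x *\<^sub>R f m x - s x *\<^sub>R f n x) \<partial>lebesgue_on \<Omega>) < e" if "e > 0" for e
  proof -
    have s_norm_pos: "L2_norm_on \<Omega> s + 1 > 0"
      using L2_norm_on_nonneg[of \<Omega> s] by linarith
    then obtain N where f_close: "\<And>m n. m \<ge> N \<Longrightarrow> n \<ge> N \<Longrightarrow>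
        L2_norm_on \<Omega> (\<lambda>x. f m x - f n x) < e / (L2_norm_on \<Omega> s + 1)"
      using L2_CauchyE[OF f_Cauchy divide_pos_pos[OF \<open>e > 0\<close>]] by blast
    have "(\<integral>x. norm (s x *\<^sub>R f m x - s x *\<^sub>R f n x) \<partial>lebesgue_on \<Omega>) < e" if "m \<ge> N" "n \<ge> N" for m n
      using L1_le_L2[of m n] f_close[OF that] L2_norm_on_nonneg[of \<Omega> "\<lambda>x. f m x - f n x"] s_norm_pos
      by (simp add: pos_less_divide_eq algebra_simps)
    then show ?thesis
      by blast
  qed
  obtain r where subseq: "strict_mono r" "AE x in lebesgue_on \<Omega>. Cauchy (\<lambda>i. s x *\<^sub>R f (r i) x)"
    using cauchy_L1_AE_cauchy_subseq[OF L2_on_scaleR_integrable[OF s_L2 f_L2] L1_Cauchy] .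
  from subseq(2) have "AE x in lebesgue_on \<Omega>. Cauchy (\<lambda>i. f (r i) x)"
  proof eventually_elim
    case (elim x)
    have "s x \<noteq> 0"
      using h_pos_int(2)[of x] by (simp add: s_def)
    with bounded_linear.Cauchy[OF bounded_linear_scaleR_right elim, of "inverse (s x)"] show ?case
      by simp
  qed
  with subseq(1) show ?thesis
    by (rule that)
qed

lemma L2_Fatou:
  fixes f :: "nat \<Rightarrow> 'a::euclidean_space \<Rightarrow> 'b::{banach, second_countable_topology}"
  assumes f_L2: "\<And>k. L2_on \<Omega> (f k)" and F_meas: "F \<in> borel_measurable (lebesgue_on \<Omega>)"
    and AE_lim: "AE x in lebesgue_on \<Omega>. (\<lambda>k. f k x) \<longlonglongrightarrow> F x"
    and f_le: "\<forall>\<^sub>F k in sequentially. L2_norm_on \<Omega> (f k) \<le> e"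
  shows "L2_on \<Omega> F" "L2_norm_on \<Omega> F \<le> e"
proof -
  let ?M = "lebesgue_on \<Omega>"
  note [measurable] = L2_on_measurable[OF f_L2] F_meas
  obtain k where "L2_norm_on \<Omega> (f k) \<le> e"
    using eventually_happens[OF f_le] by auto
  then have "e \<ge> 0"
    using L2_norm_on_nonneg[of \<Omega> "f k"] by linarith
  have "(\<integral>\<^sup>+x. ennreal ((norm (F x))\<^sup>2) \<partial>?M) = (\<integral>\<^sup>+x. liminf (\<lambda>k. ennreal ((norm (f k x))\<^sup>2)) \<partial>?M)"
  proof (rule nn_integral_cong_AE)
    show "AE x in ?M. ennreal ((norm (F x))\<^sup>2) = liminf (\<lambda>k. ennreal ((norm (f k x))\<^sup>2))"
      using AE_lim by eventually_elim (auto intro!: lim_imp_Liminf[symmetric] tendsto_intros)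
  qed
  also have "\<dots> \<le> liminf (\<lambda>k. \<integral>\<^sup>+x. ennreal ((norm (f k x))\<^sup>2) \<partial>?M)"
    by (rule nn_integral_liminf) measurable
  also have "\<dots> \<le> ennreal (e\<^sup>2)"
  proof (rule Liminf_le)
    have "(\<integral>\<^sup>+x. ennreal ((norm (f k x))\<^sup>2) \<partial>?M) = ennreal ((L2_norm_on \<Omega> (f k))\<^sup>2)" for k
      using f_L2[of k] by (simp add: L2_norm_on_power2 L2_on_def nn_integral_eq_integral)
    with f_le show "\<forall>\<^sub>F k in sequentially. (\<integral>\<^sup>+x. ennreal ((norm (f k x))\<^sup>2) \<partial>?M) \<le> ennreal (e\<^sup>2)"
      by (auto elim!: eventually_mono intro!: ennreal_leI power_mono L2_norm_on_nonneg)
  qed simp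
  finally have nn_integral_le: "(\<integral>\<^sup>+x. ennreal ((norm (F x))\<^sup>2) \<partial>?M) \<le> ennreal (e\<^sup>2)" .
  then have "integrable ?M (\<lambda>x. (norm (F x))\<^sup>2)"
    by (intro integrableI_bounded) (auto intro: le_less_trans)
  then show "L2_on \<Omega> F"
    using F_meas by (simp add: L2_on_def)
  with nn_integral_le have "(L2_norm_on \<Omega> F)\<^sup>2 \<le> e\<^sup>2"
    by (simp add: L2_norm_on_power2 L2_on_def nn_integral_eq_integral)
  then show "L2_norm_on \<Omega> F \<le> e"
    using \<open>e \<ge> 0\<close> by (rule power2_le_imp_le)
qed

lemma L2_subseq_limit_close:
  fixes f :: "nat \<Rightarrow> 'a::euclidean_space \<Rightarrow> 'b::{banach, second_countable_topology}"
  assumes f_L2: "\<And>k. L2_on \<Omega> (f k)" and F_meas: "F \<in> borel_measurable (lebesgue_on \<Omega>)"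
    and subseq: "strict_mono r" and AE_lim: "AE x in lebesgue_on \<Omega>. (\<lambda>i. f (r i) x) \<longlonglongrightarrow> F x"
    and tail: "\<And>m. m \<ge> N \<Longrightarrow> L2_norm_on \<Omega> (\<lambda>x. f m x - f n x) < e"
  shows "L2_on \<Omega> (\<lambda>x. F x - f n x)" "L2_norm_on \<Omega> (\<lambda>x. F x - f n x) \<le> e"
proof -
  have diff_L2: "L2_on \<Omega> (\<lambda>x. f (r i) x - f n x)" for i
    by (intro L2_on_diff f_L2)
  have diff_meas: "(\<lambda>x. F x - f n x) \<in> borel_measurable (lebesgue_on \<Omega>)"
    using F_meas L2_on_measurable[OF f_L2] by (rule borel_measurable_diff)
  have diff_lim: "AE x in lebesgue_on \<Omega>. (\<lambda>i. f (r i) x - f n x) \<longlonglongrightarrow> F x - f n x"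
    using AE_lim by eventually_elim (intro tendsto_intros)
  have diff_le: "\<forall>\<^sub>F i in sequentially. L2_norm_on \<Omega> (\<lambda>x. f (r i) x - f n x) \<le> e"
    using eventually_ge_at_top[of N]
    by eventually_elim (rule less_imp_le[OF tail[OF order_trans[OF _ seq_suble[OF subseq]]]])
  show "L2_on \<Omega> (\<lambda>x. F x - f n x)" "L2_norm_on \<Omega> (\<lambda>x. F x - f n x) \<le> e"
    by (rule L2_Fatou[OF diff_L2 diff_meas diff_lim diff_le])+
qed

lemma L2_complete:
  fixes f :: "nat \<Rightarrow> 'a::euclidean_space \<Rightarrow> 'b::{banach, second_countable_topology}"
  assumes meas_\<Omega>: "\<Omega> \<in> sets lebesgue" and f_Cauchy: "L2_Cauchy \<Omega> f"
  obtains F where "L2_tendsto \<Omega> f F"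
proof -
  note f_L2 = L2_Cauchy_imp_L2_on[OF f_Cauchy]
  note [measurable] = L2_on_measurable[OF f_L2]
  obtain r where subseq: "strict_mono r" "AE x in lebesgue_on \<Omega>. Cauchy (\<lambda>i. f (r i) x)"
    using L2_Cauchy_AE_Cauchy_subseq[OF meas_\<Omega> f_Cauchy] .
  define F where "F x = lim (\<lambda>i. f (r i) x)" for x
  have F_meas: "F \<in> borel_measurable (lebesgue_on \<Omega>)"
    unfolding F_def by measurable
  have AE_lim: "AE x in lebesgue_on \<Omega>. (\<lambda>i. f (r i) x) \<longlonglongrightarrow> F x"
    using subseq(2) by eventually_elim (simp add: F_def Cauchy_convergent_iff convergent_LIMSEQ_iff)
  note close = L2_subseq_limit_close[OF f_L2 F_meas subseq(1) AE_lim]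
  obtain N where "\<And>m n. m \<ge> N \<Longrightarrow> n \<ge> N \<Longrightarrow> L2_norm_on \<Omega> (\<lambda>x. f m x - f n x) < 1"
    using L2_CauchyE[OF f_Cauchy zero_less_one] by blast
  then have "L2_on \<Omega> (\<lambda>x. F x - f N x)"
    by (intro close(1)[of N N 1]) simp
  from L2_on_add[OF this f_L2[of N]] have "L2_on \<Omega> F"
    by simp
  moreover have "(\<lambda>n. L2_norm_on \<Omega> (\<lambda>x. f n x - F x)) \<longlonglongrightarrow> 0"
  proof (rule LIMSEQ_I)
    fix e :: real assume "e > 0"
    then obtain N where f_close: "\<And>m n. m \<ge> N \<Longrightarrow> n \<ge> N \<Longrightarrow> L2_norm_on \<Omega> (\<lambda>x. f m x - f n x) < e / 2"
      using L2_CauchyE[OF f_Cauchy half_gt_zero] by blast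
    have "L2_norm_on \<Omega> (\<lambda>x. F x - f n x) \<le> e / 2" if "n \<ge> N" for n
      by (intro close(2)[of N n "e / 2"] f_close that)
    then have "L2_norm_on \<Omega> (\<lambda>x. f n x - F x) < e" if "n \<ge> N" for n
      using that \<open>e > 0\<close> by (force simp: L2_norm_on_minus_commute[of \<Omega> F])
    then show "\<exists>N. \<forall>n\<ge>N. norm (L2_norm_on \<Omega> (\<lambda>x. f n x - F x) - 0) < e"
      by (auto simp: L2_norm_on_nonneg)
  qed
  ultimately show ?thesis
    using that f_L2 by (auto simp: L2_tendsto_def)
qed

section \<open>Weighted inner products\<close>

definition weighted_inner ::
  "'a::euclidean_space set \<Rightarrow> ('a \<Rightarrow> real) \<Rightarrow> ('a \<Rightarrow> 'b::euclidean_space) \<Rightarrow> ('a \<Rightarrow> 'b) \<Rightarrow> real" where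
  "weighted_inner \<Omega> a f g = (\<integral>x. a x * (f x \<bullet> g x) \<partial>lebesgue_on \<Omega>)"

lemma weighted_inner_integrable:
  fixes f g :: "'a::euclidean_space \<Rightarrow> 'b::euclidean_space"
  assumes "Linf_on \<Omega> a" "L2_on \<Omega> f" "L2_on \<Omega> g"
  shows "integrable (lebesgue_on \<Omega>) (\<lambda>x. a x * (f x \<bullet> g x))"
  using L2_bounded_bilinear_integrable[OF bounded_bilinear_inner L2_on_scaleR_Linf[OF assms(1,2)] assms(3)]
  by simp

lemma weighted_inner_commute: "weighted_inner \<Omega> a f g = weighted_inner \<Omega> a g f"
  by (simp add: weighted_inner_def inner_commute)

lemma weighted_inner_one_self: "weighted_inner \<Omega> (\<lambda>x. 1) f f = (\<integral>x. (norm (f x))\<^sup>2 \<partial>lebesgue_on \<Omega>)"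
  by (simp add: weighted_inner_def power2_norm_eq_inner)

lemma weighted_inner_scaleR_right: "weighted_inner \<Omega> a f (\<lambda>x. c *\<^sub>R g x) = c * weighted_inner \<Omega> a f g"
  by (simp add: weighted_inner_def mult.left_commute)

lemma weighted_inner_scaleR_left: "weighted_inner \<Omega> a (\<lambda>x. c *\<^sub>R f x) g = c * weighted_inner \<Omega> a f g"
  by (simp add: weighted_inner_def mult.left_commute)

lemma weighted_inner_diff_left:
  assumes "Linf_on \<Omega> a" "L2_on \<Omega> f" "L2_on \<Omega> g" "L2_on \<Omega> h"
  shows "weighted_inner \<Omega> a (\<lambda>x. f x - g x) h = weighted_inner \<Omega> a f h - weighted_inner \<Omega> a g h"
  by (simp add: weighted_inner_def inner_diff_left right_diff_distrib weighted_inner_integrable assms)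

lemma weighted_inner_diff_right:
  assumes "Linf_on \<Omega> a" "L2_on \<Omega> f" "L2_on \<Omega> g" "L2_on \<Omega> h"
  shows "weighted_inner \<Omega> a h (\<lambda>x. f x - g x) = weighted_inner \<Omega> a h f - weighted_inner \<Omega> a h g"
  using weighted_inner_diff_left[OF assms] by (simp add: weighted_inner_commute)

lemma weighted_inner_diff_weight:
  assumes "Linf_on \<Omega> a" "Linf_on \<Omega> b" "L2_on \<Omega> f" "L2_on \<Omega> g"
  shows "weighted_inner \<Omega> (\<lambda>x. a x - b x) f g = weighted_inner \<Omega> a f g - weighted_inner \<Omega> b f g"
  by (simp add: weighted_inner_def left_diff_distrib weighted_inner_integrable assms)

lemma weighted_inner_add_self:
  assumes "Linf_on \<Omega> a" "L2_on \<Omega> f" "L2_on \<Omega> g"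
  shows "weighted_inner \<Omega> a (\<lambda>x. f x + g x) (\<lambda>x. f x + g x)
    = weighted_inner \<Omega> a f f + 2 * weighted_inner \<Omega> a f g + weighted_inner \<Omega> a g g"
proof -
  have "a x * ((f x + g x) \<bullet> (f x + g x))
      = a x * (f x \<bullet> f x) + 2 * (a x * (f x \<bullet> g x)) + a x * (g x \<bullet> g x)" for x
    by (simp add: inner_add inner_commute algebra_simps)
  then show ?thesis
    by (simp add: weighted_inner_def weighted_inner_integrable assms)
qed

lemma weighted_inner_diff_self:
  assumes "Linf_on \<Omega> a" "L2_on \<Omega> f" "L2_on \<Omega> g"
  shows "weighted_inner \<Omega> a (\<lambda>x. f x - g x) (\<lambda>x. f x - g x)
    = weighted_inner \<Omega> a f f - 2 * weighted_inner \<Omega> a f g + weighted_inner \<Omega> a g g"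
  using weighted_inner_add_self[OF assms(1,2) L2_on_scaleR[OF assms(3), of "-1"]]
    weighted_inner_scaleR_right[of \<Omega> a _ "-1" g] weighted_inner_scaleR_left[of \<Omega> a "-1" g] by simp

lemma weighted_inner_cong_weight:
  assumes "a \<in> borel_measurable (lebesgue_on \<Omega>)" "b \<in> borel_measurable (lebesgue_on \<Omega>)"
    "L2_on \<Omega> f" "L2_on \<Omega> g"
    and "AE x in lebesgue_on \<Omega>. a x = b x"
  shows "weighted_inner \<Omega> a f g = weighted_inner \<Omega> b f g"
  unfolding weighted_inner_def
  by (rule integral_cong_AE) (use assms in \<open>auto simp: L2_on_def\<close>)

lemma weighted_inner_one_scaleR:
  assumes "Linf_on \<Omega> b" "Linf_on \<Omega> c" "Linf_on \<Omega> a" "L2_on \<Omega> f" "L2_on \<Omega> g"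
    and "AE x in lebesgue_on \<Omega>. b x * c x = a x"
  shows "weighted_inner \<Omega> (\<lambda>x. 1) (\<lambda>x. b x *\<^sub>R f x) (\<lambda>x. c x *\<^sub>R g x) = weighted_inner \<Omega> a f g"
proof -
  have "weighted_inner \<Omega> (\<lambda>x. 1) (\<lambda>x. b x *\<^sub>R f x) (\<lambda>x. c x *\<^sub>R g x)
      = weighted_inner \<Omega> (\<lambda>x. b x * c x) f g"
    by (simp add: weighted_inner_def mult.left_commute mult.assoc)
  also have "\<dots> = weighted_inner \<Omega> a f g"
    by (intro weighted_inner_cong_weight Linf_on_measurable Linf_on_mult assms)
  finally show ?thesis .
qed

lemma weighted_inner_cong_right:
  assumes "Linf_on \<Omega> a" "L2_on \<Omega> f" "L2_on \<Omega> g" "L2_on \<Omega> h" and "AE x in lebesgue_on \<Omega>. g x = h x"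
  shows "weighted_inner \<Omega> a f g = weighted_inner \<Omega> a f h"
  unfolding weighted_inner_def
  by (rule integral_cong_AE) (use assms in \<open>auto simp: L2_on_def Linf_on_def\<close>)

lemma weighted_inner_self_nonneg:
  assumes "AE x in lebesgue_on \<Omega>. 0 \<le> a x"
  shows "0 \<le> weighted_inner \<Omega> a f f"
  unfolding weighted_inner_def
  by (rule integral_nonneg_AE) (use assms in \<open>auto elim!: eventually_mono\<close>)

lemma weighted_inner_tendsto:
  assumes "Linf_on \<Omega> a" "L2_tendsto \<Omega> f F" "L2_tendsto \<Omega> g G"
  shows "(\<lambda>k. weighted_inner \<Omega> a (f k) (g k)) \<longlonglongrightarrow> weighted_inner \<Omega> a F G"
  using L2_tendsto_integral_bounded_bilinear[OF bounded_bilinear_inner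
      L2_tendsto_scaleR_Linf[OF assms(1,2)] assms(3)]
  by (simp add: weighted_inner_def)

lemma weighted_inner_coercive:
  assumes "elliptic_on \<Omega> a"
  shows "\<exists>c>0. \<forall>f :: 'a::euclidean_space \<Rightarrow> 'b::euclidean_space.
    L2_on \<Omega> f \<longrightarrow> c * (L2_norm_on \<Omega> f)\<^sup>2 \<le> weighted_inner \<Omega> a f f"
proof -
  obtain c where "c > 0" and a_ge: "AE x in lebesgue_on \<Omega>. c \<le> a x"
    using assms by (auto simp: elliptic_on_def)
  have "c * (L2_norm_on \<Omega> f)\<^sup>2 \<le> weighted_inner \<Omega> a f f" if f_L2: "L2_on \<Omega> f" for f :: "'a \<Rightarrow> 'b"
  proof -
    have "(\<integral>x. c * (norm (f x))\<^sup>2 \<partial>lebesgue_on \<Omega>) \<le> weighted_inner \<Omega> a f f"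
      unfolding weighted_inner_def
    proof (rule integral_mono_AE)
      show "AE x in lebesgue_on \<Omega>. c * (norm (f x))\<^sup>2 \<le> a x * (f x \<bullet> f x)"
        using a_ge by eventually_elim (simp add: power2_norm_eq_inner mult_right_mono)
    qed (use f_L2 in \<open>simp_all add: L2_on_def weighted_inner_integrable elliptic_on_imp_Linf_on assms\<close>)
    then show ?thesis
      by (simp add: L2_norm_on_power2)
  qed
  with \<open>c > 0\<close> show ?thesis
    by blast
qed

section \<open>Minimisation of the energy\<close>

text \<open>By the parallelogram identity, two almost minimising functions are close because the energy of
  their midpoint is at least \<open>m\<close>.\<close>
lemma minimising_sequence_L2_Cauchy:
  fixes f :: "nat \<Rightarrow> 'a::euclidean_space \<Rightarrow> 'b::euclidean_space"
  assumes a_ell: "elliptic_on \<Omega> a" and f_L2: "\<And>k. L2_on \<Omega> (f k)"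
    and midpoint_ge: "\<And>i j.
      m \<le> weighted_inner \<Omega> a (\<lambda>x. (1/2) *\<^sub>R (f i x + f j x)) (\<lambda>x. (1/2) *\<^sub>R (f i x + f j x))"
    and energy_less: "\<And>k. weighted_inner \<Omega> a (f k) (f k) < m + inverse (real (Suc k))"
  shows "L2_Cauchy \<Omega> f"
  unfolding L2_Cauchy_def
proof (intro conjI allI impI f_L2)
  fix e :: real assume "e > 0"
  let ?d = "\<lambda>i j x. f i x - f j x"
  note a_Linf = elliptic_on_imp_Linf_on[OF a_ell]
  obtain c where "c > 0" and coercive: "\<And>g :: 'a \<Rightarrow> 'b. L2_on \<Omega> g \<Longrightarrow>
      c * (L2_norm_on \<Omega> g)\<^sup>2 \<le> weighted_inner \<Omega> a g g"
    using weighted_inner_coercive[OF a_ell, where 'b='b] by auto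
  have power2_diff_less: "c * (L2_norm_on \<Omega> (?d i j))\<^sup>2
      < 2 * inverse (real (Suc i)) + 2 * inverse (real (Suc j))" for i j
  proof -
    have "4 * m \<le> weighted_inner \<Omega> a (\<lambda>x. f i x + f j x) (\<lambda>x. f i x + f j x)"
      using midpoint_ge[of i j] unfolding weighted_inner_scaleR_left weighted_inner_scaleR_right
      by linarith
    moreover have "c * (L2_norm_on \<Omega> (?d i j))\<^sup>2 \<le> weighted_inner \<Omega> a (?d i j) (?d i j)"
      by (intro coercive L2_on_diff f_L2)
    ultimately show ?thesis
      using energy_less[of i] energy_less[of j]
        weighted_inner_add_self[OF a_Linf f_L2 f_L2, of i j]
        weighted_inner_diff_self[OF a_Linf f_L2 f_L2, of i j]
      by linarith
  qed
  obtain N where inverse_N: "inverse (real (Suc N)) < c * e\<^sup>2 / 4"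
    using reals_Archimedean[of "c * e\<^sup>2 / 4"] \<open>c > 0\<close> \<open>e > 0\<close> by auto
  have inverse_le: "inverse (real (Suc k)) \<le> inverse (real (Suc N))" if "k \<ge> N" for k
    using that by (intro le_imp_inverse_le) auto
  have "L2_norm_on \<Omega> (?d i j) < e" if "i \<ge> N" "j \<ge> N" for i j
  proof (rule power2_less_imp_less)
    have "c * (L2_norm_on \<Omega> (?d i j))\<^sup>2 < c * e\<^sup>2"
      using power2_diff_less[of i j] inverse_le[OF that(1)] inverse_le[OF that(2)] inverse_N by linarith
    then show "(L2_norm_on \<Omega> (?d i j))\<^sup>2 < e\<^sup>2"
      using \<open>c > 0\<close> by simp
  qed (use \<open>e > 0\<close> in simp)
  then show "\<exists>N. \<forall>i\<ge>N. \<forall>j\<ge>N. L2_norm_on \<Omega> (?d i j) < e"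
    by blast
qed

lemma ex_energy_minimiser:
  assumes meas_\<Omega>: "\<Omega> \<in> sets lebesgue" and a_ell: "elliptic_on \<Omega> a" and "S \<noteq> {}"
    and S_L2: "\<And>f. f \<in> S \<Longrightarrow> L2_on \<Omega> f"
    and S_midpoint: "\<And>f g. f \<in> S \<Longrightarrow> g \<in> S \<Longrightarrow> (\<lambda>x. (1/2) *\<^sub>R (f x + g x)) \<in> S"
  obtains f F where "\<And>k. f k \<in> S" "L2_tendsto \<Omega> f F"
    "\<And>h. h \<in> S \<Longrightarrow> weighted_inner \<Omega> a F F \<le> weighted_inner \<Omega> a h h"
proof -
  let ?J = "\<lambda>h. weighted_inner \<Omega> a h h"
  define m where "m = (INF h\<in>S. ?J h)"
  have "AE x in lebesgue_on \<Omega>. 0 \<le> a x"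
    using elliptic_on_AE_pos[OF a_ell] by eventually_elim simp
  then have "bdd_below (?J ` S)"
    by (intro bdd_belowI2[of _ 0] weighted_inner_self_nonneg)
  then have m_le: "m \<le> ?J h" if "h \<in> S" for h
    unfolding m_def using that by (rule cINF_lower)
  have "\<exists>h\<in>S. ?J h < m + inverse (real (Suc k))" for k
    using cInf_lessD[of "?J ` S" "m + inverse (real (Suc k))"] \<open>S \<noteq> {}\<close> by (auto simp: m_def)
  then obtain f where f_minimising: "\<And>k. f k \<in> S" "\<And>k. ?J (f k) < m + inverse (real (Suc k))"
    by metis
  have "L2_Cauchy \<Omega> f"
    by (rule minimising_sequence_L2_Cauchy[OF a_ell S_L2 m_le]) (intro f_minimising S_midpoint)+
  then obtain F where f_lim: "L2_tendsto \<Omega> f F"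
    using L2_complete[OF meas_\<Omega>] by blast
  have "?J F \<le> m"
  proof (rule LIMSEQ_le)
    show "(\<lambda>k. ?J (f k)) \<longlonglongrightarrow> ?J F"
      by (rule weighted_inner_tendsto[OF elliptic_on_imp_Linf_on[OF a_ell] f_lim f_lim])
    show "(\<lambda>k. m + inverse (real (Suc k))) \<longlonglongrightarrow> m"
      using tendsto_add[OF tendsto_const LIMSEQ_inverse_real_of_nat, of m] by simp
    show "\<exists>N. \<forall>k\<ge>N. ?J (f k) \<le> m + inverse (real (Suc k))"
      using f_minimising(2) less_imp_le by blast
  qed
  then have "?J F \<le> ?J h" if "h \<in> S" for h
    using m_le[OF that] by linarith
  with f_minimising(1) f_lim show ?thesis
    by (rule that)
qed

lemma energy_minimiser_orthogonal:
  assumes a_Linf: "Linf_on \<Omega> a" and f_lim: "L2_tendsto \<Omega> f F" and E_L2: "L2_on \<Omega> E"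
    and F_min: "\<And>k t. weighted_inner \<Omega> a F F
        \<le> weighted_inner \<Omega> a (\<lambda>x. f k x + t *\<^sub>R E x) (\<lambda>x. f k x + t *\<^sub>R E x)"
  shows "weighted_inner \<Omega> a F E = 0"
proof (rule DERIV_local_min[OF _ zero_less_one])
  let ?J = "\<lambda>t. weighted_inner \<Omega> a F F + 2 * t * weighted_inner \<Omega> a F E + t\<^sup>2 * weighted_inner \<Omega> a E E"
  have "weighted_inner \<Omega> a F F \<le> weighted_inner \<Omega> a (\<lambda>x. F x + t *\<^sub>R E x) (\<lambda>x. F x + t *\<^sub>R E x)" for t
  proof (rule LIMSEQ_le_const)
    have "L2_tendsto \<Omega> (\<lambda>k x. f k x + t *\<^sub>R E x) (\<lambda>x. F x + t *\<^sub>R E x)"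
      by (intro L2_tendsto_add f_lim L2_tendsto_const L2_on_scaleR E_L2)
    then show "(\<lambda>k. weighted_inner \<Omega> a (\<lambda>x. f k x + t *\<^sub>R E x) (\<lambda>x. f k x + t *\<^sub>R E x))
        \<longlonglongrightarrow> weighted_inner \<Omega> a (\<lambda>x. F x + t *\<^sub>R E x) (\<lambda>x. F x + t *\<^sub>R E x)"
      by (intro weighted_inner_tendsto a_Linf)
  qed (use F_min in blast)
  also have "weighted_inner \<Omega> a (\<lambda>x. F x + t *\<^sub>R E x) (\<lambda>x. F x + t *\<^sub>R E x) = ?J t" for t
    using weighted_inner_add_self[OF a_Linf L2_tendsto_imp_L2_on(2)[OF f_lim] L2_on_scaleR[OF E_L2], of t]
    by (simp add: weighted_inner_scaleR_left weighted_inner_scaleR_right power2_eq_square mult.assoc)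
  finally show "\<forall>t. \<bar>0 - t\<bar> < 1 \<longrightarrow> ?J 0 / 2 \<le> ?J t / 2"
    by simp
  show "((\<lambda>t. ?J t / 2) has_real_derivative weighted_inner \<Omega> a F E) (at 0)"
    by (auto intro!: derivative_eq_intros)
qed

lemma ex_energy_projection:
  assumes meas_\<Omega>: "\<Omega> \<in> sets lebesgue" and a_ell: "elliptic_on \<Omega> a" and g_L2: "L2_on \<Omega> g"
    and V_nonempty: "V \<noteq> {}" and V_L2: "\<And>D. D \<in> V \<Longrightarrow> L2_on \<Omega> D"
    and V_add: "\<And>D E. D \<in> V \<Longrightarrow> E \<in> V \<Longrightarrow> (\<lambda>x. D x + E x) \<in> V"
    and V_scaleR: "\<And>D t. D \<in> V \<Longrightarrow> (\<lambda>x. t *\<^sub>R D x) \<in> V"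
  obtains D W where "\<And>k. D k \<in> V" "L2_tendsto \<Omega> (\<lambda>k x. g x + D k x) W"
    "\<And>E. E \<in> V \<Longrightarrow> weighted_inner \<Omega> a W E = 0"
proof -
  define S where "S = (\<lambda>D x. g x + D x) ` V"
  have S_L2: "L2_on \<Omega> f" if "f \<in> S" for f
    using that by (auto simp: S_def intro: L2_on_add[OF g_L2 V_L2])
  have S_midpoint: "(\<lambda>x. (1/2) *\<^sub>R (f x + h x)) \<in> S" if f_in_S: "f \<in> S" and h_in_S: "h \<in> S" for f h
  proof -
    obtain D E where "D \<in> V" "E \<in> V" and fh_def: "f = (\<lambda>x. g x + D x)" "h = (\<lambda>x. g x + E x)"
      using f_in_S h_in_S by (auto simp: S_def)
    moreover have "(1/2) *\<^sub>R (f x + h x) = g x + (1/2) *\<^sub>R (D x + E x)" for x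
      using scaleR_half_double[of "g x"] by (simp add: fh_def scaleR_add_right algebra_simps)
    ultimately show ?thesis
      unfolding S_def
      by (intro image_eqI[of _ _ "\<lambda>x. (1/2) *\<^sub>R (D x + E x)"]) (simp_all add: V_add V_scaleR)
  qed
  obtain f W where f_seq_S: "\<And>k. f k \<in> S" and f_lim: "L2_tendsto \<Omega> f W"
    and W_min: "\<And>h. h \<in> S \<Longrightarrow> weighted_inner \<Omega> a W W \<le> weighted_inner \<Omega> a h h"
    using ex_energy_minimiser[OF meas_\<Omega> a_ell _ S_L2 S_midpoint] V_nonempty by (auto simp: S_def)
  obtain D where D_in_V: "\<And>k. D k \<in> V" and f_eq: "\<And>k. f k = (\<lambda>x. g x + D k x)"
    using f_seq_S unfolding S_def image_iff by metis
  have "weighted_inner \<Omega> a W E = 0" if "E \<in> V" for E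
  proof (rule energy_minimiser_orthogonal[OF elliptic_on_imp_Linf_on[OF a_ell] f_lim V_L2[OF that]])
    fix k t
    have "(\<lambda>x. g x + (D k x + t *\<^sub>R E x)) \<in> S"
      unfolding S_def using D_in_V that by (intro imageI V_add V_scaleR)
    then show "weighted_inner \<Omega> a W W
        \<le> weighted_inner \<Omega> a (\<lambda>x. f k x + t *\<^sub>R E x) (\<lambda>x. f k x + t *\<^sub>R E x)"
      using W_min by (simp add: f_eq add.assoc)
  qed
  with D_in_V f_lim show ?thesis
    by (intro that[of D W]) (simp_all add: f_eq[abs_def])
qed

section \<open>Test functions\<close>

lemma test_fun_has_derivative: "test_fun \<Omega> \<phi> D \<Longrightarrow> (\<phi> has_derivative (\<lambda>h. D x \<bullet> h)) (at x)"
  by (simp add: test_fun_def)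

lemma test_fun_continuous_on:
  assumes "test_fun \<Omega> \<phi> D"
  shows "continuous_on UNIV \<phi>" "continuous_on UNIV D"
proof -
  show "continuous_on UNIV \<phi>"
    by (rule has_derivative_continuous_on
        [OF has_derivative_at_withinI[OF test_fun_has_derivative[OF assms]]])
  show "continuous_on UNIV D"
    using assms by (simp add: test_fun_def)
qed

lemma test_funI:
  assumes "\<And>x. (\<phi> has_derivative (\<lambda>h. D x \<bullet> h)) (at x)" "continuous_on UNIV D"
    and "compact K" "K \<subseteq> \<Omega>" "\<And>x. x \<notin> K \<Longrightarrow> \<phi> x = 0"
  shows "test_fun \<Omega> \<phi> D"
proof -
  have "closure {x. \<phi> x \<noteq> 0} \<subseteq> K"
    using assms(3,5) by (intro closure_minimal compact_imp_closed) auto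
  moreover from this have "compact (closure {x. \<phi> x \<noteq> 0})"
    using compact_Int_closed[OF assms(3) closed_closure, of "{x. \<phi> x \<noteq> 0}"] by (simp add: Int_absorb1)
  ultimately show ?thesis
    using assms by (auto simp: test_fun_def)
qed

lemma test_fun_support:
  assumes "test_fun \<Omega> \<phi> D"
  obtains K where "compact K" "K \<subseteq> \<Omega>" "\<And>x. x \<notin> K \<Longrightarrow> \<phi> x = 0" "\<And>x. x \<notin> K \<Longrightarrow> D x = 0"
proof
  let ?K = "closure {x. \<phi> x \<noteq> 0}"
  show "compact ?K" "?K \<subseteq> \<Omega>"
    using assms by (simp_all add: test_fun_def)
  show zero: "\<phi> x = 0" if "x \<notin> ?K" for x
    using that closure_subset[of "{x. \<phi> x \<noteq> 0}"] by auto
  show "D x = 0" if "x \<notin> ?K" for x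
  proof -
    have "(\<phi> has_derivative (\<lambda>h. 0)) (at x)"
    proof (rule has_derivative_transform_within_open[OF has_derivative_const])
      show "open (- ?K)" "x \<in> - ?K"
        using that by auto
      show "0 = \<phi> y" if "y \<in> - ?K" for y
        using that zero[of y] by simp
    qed
    with test_fun_has_derivative[OF assms] have "(\<lambda>h. D x \<bullet> h) = (\<lambda>h. 0)"
      by (rule has_derivative_unique)
    then show ?thesis
      by (metis inner_eq_zero_iff)
  qed
qed

lemma test_fun_mono: "test_fun U \<phi> D \<Longrightarrow> U \<subseteq> \<Omega> \<Longrightarrow> test_fun \<Omega> \<phi> D"
  by (auto simp: test_fun_def)

lemma test_fun_zero: "test_fun \<Omega> (\<lambda>x. 0) (\<lambda>x. 0)"
  by (simp add: test_fun_def)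

lemma test_fun_add:
  assumes "test_fun \<Omega> \<phi> D" "test_fun \<Omega> \<psi> E"
  shows "test_fun \<Omega> (\<lambda>x. \<phi> x + \<psi> x) (\<lambda>x. D x + E x)"
proof -
  obtain K where \<phi>_support: "compact K" "K \<subseteq> \<Omega>" "\<And>x. x \<notin> K \<Longrightarrow> \<phi> x = 0"
    using test_fun_support[OF assms(1)] by metis
  obtain L where \<psi>_support: "compact L" "L \<subseteq> \<Omega>" "\<And>x. x \<notin> L \<Longrightarrow> \<psi> x = 0"
    using test_fun_support[OF assms(2)] by metis
  show ?thesis
  proof (rule test_funI)
    show "((\<lambda>x. \<phi> x + \<psi> x) has_derivative (\<lambda>h. (D x + E x) \<bullet> h)) (at x)" for x
      using has_derivative_add[OF assms[THEN test_fun_has_derivative]] by (simp add: inner_add_left)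
    show "continuous_on UNIV (\<lambda>x. D x + E x)"
      by (intro continuous_on_add assms[THEN test_fun_continuous_on(2)])
    show "compact (K \<union> L)"
      using \<phi>_support \<psi>_support by (intro compact_Un)
  qed (use \<phi>_support \<psi>_support in auto)
qed

lemma test_fun_mult_C1:
  assumes test_\<phi>: "test_fun \<Omega> \<phi> D"
    and g_C1: "\<And>x. (g has_derivative (\<lambda>h. Dg x \<bullet> h)) (at x)" "continuous_on UNIV Dg"
  shows "test_fun \<Omega> (\<lambda>x. g x * \<phi> x) (\<lambda>x. g x *\<^sub>R D x + \<phi> x *\<^sub>R Dg x)"
proof -
  obtain K where \<phi>_support: "compact K" "K \<subseteq> \<Omega>" "\<And>x. x \<notin> K \<Longrightarrow> \<phi> x = 0"
    using test_fun_support[OF test_\<phi>] by metis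
  have "continuous_on UNIV g"
    by (rule has_derivative_continuous_on[OF has_derivative_at_withinI[OF g_C1(1)]])
  then have "continuous_on UNIV (\<lambda>x. g x *\<^sub>R D x + \<phi> x *\<^sub>R Dg x)"
    using test_fun_continuous_on[OF test_\<phi>] g_C1(2) by (intro continuous_intros)
  moreover have "((\<lambda>x. g x * \<phi> x) has_derivative (\<lambda>h. (g x *\<^sub>R D x + \<phi> x *\<^sub>R Dg x) \<bullet> h)) (at x)" for x
    by (rule has_derivative_eq_rhs[OF has_derivative_mult[OF g_C1(1) test_fun_has_derivative[OF test_\<phi>]]])
       (auto simp: algebra_simps)
  ultimately show ?thesis
    using \<phi>_support by (intro test_funI) auto
qed

lemma test_fun_scaleR:
  assumes "test_fun \<Omega> \<phi> D"
  shows "test_fun \<Omega> (\<lambda>x. c * \<phi> x) (\<lambda>x. c *\<^sub>R D x)"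
  using test_fun_mult_C1[OF assms, of "\<lambda>x. c" "\<lambda>x. 0"] by simp

lemma test_fun_diff:
  assumes "test_fun \<Omega> \<phi> D" "test_fun \<Omega> \<psi> E"
  shows "test_fun \<Omega> (\<lambda>x. \<phi> x - \<psi> x) (\<lambda>x. D x - E x)"
  using test_fun_add[OF assms(1) test_fun_scaleR[OF assms(2), of "-1"]] by simp

lemma test_fun_mult:
  assumes "test_fun \<Omega> \<phi> D" "test_fun \<Omega> \<psi> E"
  shows "test_fun \<Omega> (\<lambda>x. \<phi> x * \<psi> x) (\<lambda>x. \<phi> x *\<^sub>R E x + \<psi> x *\<^sub>R D x)"
  using assms by (intro test_fun_mult_C1 test_fun_has_derivative test_fun_continuous_on(2))

lemma test_fun_sum:
  assumes "finite A" "\<And>i. i \<in> A \<Longrightarrow> test_fun \<Omega> (\<phi> i) (D i)"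
  shows "test_fun \<Omega> (\<lambda>x. \<Sum>i\<in>A. \<phi> i x) (\<lambda>x. \<Sum>i\<in>A. D i x)"
  using assms by (induction A) (simp_all add: test_fun_zero test_fun_add)

lemma test_fun_compose_C1:
  fixes h h' :: "real \<Rightarrow> real"
  assumes test_\<phi>: "test_fun \<Omega> \<phi> D"
    and h_C1: "\<And>t. (h has_real_derivative h' t) (at t)" "continuous_on UNIV h'" "h 0 = 0"
  shows "test_fun \<Omega> (\<lambda>x. h (\<phi> x)) (\<lambda>x. h' (\<phi> x) *\<^sub>R D x)"
proof -
  obtain K where \<phi>_support: "compact K" "K \<subseteq> \<Omega>" "\<And>x. x \<notin> K \<Longrightarrow> \<phi> x = 0"
    using test_fun_support[OF test_\<phi>] by metis
  have "((\<lambda>x. h (\<phi> x)) has_derivative (\<lambda>v. (h' (\<phi> x) *\<^sub>R D x) \<bullet> v)) (at x)" for x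
    using has_derivative_compose[OF test_fun_has_derivative[OF test_\<phi>, of x]
        h_C1(1)[unfolded has_field_derivative_def]]
    by simp
  moreover have "continuous_on UNIV (\<lambda>x. h' (\<phi> x) *\<^sub>R D x)"
    using test_fun_continuous_on[OF test_\<phi>]
    by (intro continuous_intros continuous_on_compose2[OF h_C1(2)]) auto
  ultimately show ?thesis
    using \<phi>_support h_C1(3) by (intro test_funI) auto
qed

section \<open>Cut-off functions\<close>

lemma has_real_derivative_max_zero_power2:
  "((\<lambda>s::real. (max 0 s)\<^sup>2) has_real_derivative 2 * max 0 s) (at s)"
proof -
  consider "s < 0" | "s = 0" | "s > 0"
    by linarith
  then show ?thesis
  proof cases
    assume "s < 0"
    then have "((\<lambda>s::real. 0) has_real_derivative 2 * max 0 s) (at s)"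
      by simp
    then show ?thesis
      by (rule has_field_derivative_transform_within_open[where S="{..<0}"]) (use \<open>s < 0\<close> in auto)
  next
    assume "s = 0"
    have "((\<lambda>h::real. max 0 h) \<longlongrightarrow> max 0 0) (at 0)"
      by (intro tendsto_intros)
    moreover have "(max 0 h)\<^sup>2 / h = max 0 h" for h :: real
      by (auto simp: max_def power2_eq_square)
    ultimately show ?thesis
      using \<open>s = 0\<close> by (simp add: has_field_derivative_iff)
  next
    assume "s > 0"
    then have "((\<lambda>s::real. s\<^sup>2) has_real_derivative 2 * max 0 s) (at s)"
      by (auto intro!: derivative_eq_intros)
    then show ?thesis
      by (rule has_field_derivative_transform_within_open[where S="{0<..}"]) (use \<open>s > 0\<close> in auto)
  qed
qed

lemma ex_test_fun_pos_on_ball: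
  fixes c :: "'a::euclidean_space"
  assumes "cball c r \<subseteq> \<Omega>"
  shows "\<exists>\<phi> D. test_fun \<Omega> \<phi> D \<and> (\<forall>x. 0 \<le> \<phi> x) \<and> (\<forall>x\<in>ball c r. 0 < \<phi> x)"
proof (cases "r > 0")
  case False
  then show ?thesis
    by (auto intro!: exI[of _ "\<lambda>x. 0"] test_fun_zero dest: le_less_trans[OF zero_le_dist])
next
  case True
  define p where "p x = r\<^sup>2 - (x - c) \<bullet> (x - c)" for x
  define D where "D x = (- 4 * max 0 (p x)) *\<^sub>R (x - c)" for x
  have p_pos: "p x > 0 \<longleftrightarrow> x \<in> ball c r" for x
    using True power_mono_iff[of r "dist c x" 2]
    by (simp add: p_def dist_norm norm_minus_commute flip: power2_norm_eq_inner not_le)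
  have "test_fun \<Omega> (\<lambda>x. (max 0 (p x))\<^sup>2) D"
  proof (rule test_funI[OF _ _ compact_cball assms])
    fix x
    have "(p has_derivative (\<lambda>h. - 2 * ((x - c) \<bullet> h))) (at x)"
      unfolding p_def by (auto intro!: derivative_eq_intros simp: algebra_simps inner_commute)
    from has_derivative_compose[OF this
        has_real_derivative_max_zero_power2[unfolded has_field_derivative_def]]
    show "((\<lambda>x. (max 0 (p x))\<^sup>2) has_derivative (\<lambda>h. D x \<bullet> h)) (at x)"
      by (rule has_derivative_eq_rhs) (simp add: fun_eq_iff D_def)
    show "(max 0 (p x))\<^sup>2 = 0" if "x \<notin> cball c r"
      using that p_pos[of x] by (auto simp: max_def)
  next
    show "continuous_on UNIV D"
      unfolding D_def p_def by (intro continuous_intros)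
  qed
  then show ?thesis
    by (intro exI[of _ "\<lambda>x. (max 0 (p x))\<^sup>2"] exI[of _ D]) (use p_pos in force)
qed

lemma ex_test_fun_pos_on_compact:
  fixes \<Omega> :: "'a::euclidean_space set"
  assumes "open \<Omega>" "compact K" "K \<subseteq> \<Omega>"
  obtains \<phi> D where "test_fun \<Omega> \<phi> D" "\<And>x. 0 \<le> \<phi> x" "\<And>x. x \<in> K \<Longrightarrow> 0 < \<phi> x"
proof -
  have "\<forall>x\<in>K. \<exists>r>0. cball x r \<subseteq> \<Omega>"
    using assms open_contains_cball by blast
  then obtain r where radius: "\<And>x. x \<in> K \<Longrightarrow> r x > 0" "\<And>x. x \<in> K \<Longrightarrow> cball x (r x) \<subseteq> \<Omega>"
    by metis
  have "K \<subseteq> (\<Union>c\<in>K. ball c (r c))"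
    using radius(1) by auto
  then obtain C where cover: "C \<subseteq> K" "finite C" "K \<subseteq> (\<Union>c\<in>C. ball c (r c))"
    by (rule compactE_image[OF assms(2) open_ball])
  have "\<forall>c\<in>C. \<exists>\<phi> D. test_fun \<Omega> \<phi> D \<and> (\<forall>x. 0 \<le> \<phi> x) \<and> (\<forall>x\<in>ball c (r c). 0 < \<phi> x)"
    using cover(1) radius(2) by (blast intro: ex_test_fun_pos_on_ball)
  then obtain \<phi> D where \<phi>_pos: "\<And>c. c \<in> C \<Longrightarrow> test_fun \<Omega> (\<phi> c) (D c)" "\<And>c x. c \<in> C \<Longrightarrow> 0 \<le> \<phi> c x"
    "\<And>c x. c \<in> C \<Longrightarrow> x \<in> ball c (r c) \<Longrightarrow> 0 < \<phi> c x"
    by metis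
  have "0 < (\<Sum>c\<in>C. \<phi> c x)" if "x \<in> K" for x
  proof -
    obtain c where "c \<in> C" "x \<in> ball c (r c)"
      using cover(3) \<open>x \<in> K\<close> by blast
    then show ?thesis
      using cover(2) \<phi>_pos(2,3) by (intro sum_pos2) auto
  qed
  moreover have "test_fun \<Omega> (\<lambda>x. \<Sum>c\<in>C. \<phi> c x) (\<lambda>x. \<Sum>c\<in>C. D c x)"
    using cover(2) \<phi>_pos(1) by (rule test_fun_sum)
  ultimately show ?thesis
    using that by (metis (no_types, lifting) \<phi>_pos(2) sum_nonneg)
qed

lemma ex_test_fun_cutoff:
  fixes \<Omega> :: "'a::euclidean_space set"
  assumes "open \<Omega>" "compact K" "K \<subseteq> \<Omega>"
  shows "\<exists>\<phi> D. test_fun \<Omega> \<phi> D \<and> (\<forall>x. 0 \<le> \<phi> x \<and> \<phi> x \<le> 1) \<and> (\<forall>x\<in>K. \<phi> x = 1)"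
proof -
  obtain s D where s_pos: "test_fun \<Omega> s D" "\<And>x. 0 \<le> s x" "\<And>x. x \<in> K \<Longrightarrow> 0 < s x"
    using ex_test_fun_pos_on_compact[OF assms] by blast
  obtain \<epsilon> where "\<epsilon> > 0" and \<epsilon>_le: "\<And>x. x \<in> K \<Longrightarrow> \<epsilon> \<le> s x"
  proof (cases "K = {}")
    case False
    have "continuous_on K s"
      using test_fun_continuous_on(1)[OF s_pos(1)] by (rule continuous_on_subset) simp
    then obtain y where "y \<in> K" "\<And>x. x \<in> K \<Longrightarrow> s y \<le> s x"
      using continuous_attains_inf[OF assms(2) False] by blast
    with s_pos(3) show ?thesis
      by (blast intro: that)
  qed (use that[of 1] in simp)
  define h where "h t = 1 - (max 0 (1 - t / \<epsilon>))\<^sup>2" for t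
  have "(h has_real_derivative 2 * max 0 (1 - t / \<epsilon>) / \<epsilon>) (at t)" for t
  proof -
    have "((\<lambda>t. 1 - t / \<epsilon>) has_real_derivative - (1 / \<epsilon>)) (at t)"
      using \<open>\<epsilon> > 0\<close> by (auto intro!: derivative_eq_intros)
    from DERIV_diff[OF DERIV_const[of 1] DERIV_chain2[OF has_real_derivative_max_zero_power2 this]]
    show ?thesis
      by (simp add: h_def[abs_def])
  qed
  then have "test_fun \<Omega> (\<lambda>x. h (s x)) (\<lambda>x. (2 * max 0 (1 - s x / \<epsilon>) / \<epsilon>) *\<^sub>R D x)"
    by (rule test_fun_compose_C1[OF s_pos(1)])
       (use \<open>\<epsilon> > 0\<close> in \<open>auto simp: h_def intro!: continuous_intros\<close>)
  moreover have "0 \<le> h (s x)" "h (s x) \<le> 1" for x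
    using s_pos(2)[of x] \<open>\<epsilon> > 0\<close> by (auto simp: h_def power_le_one_iff)
  moreover have "h (s x) = 1" if "x \<in> K" for x
    using \<epsilon>_le[OF that] \<open>\<epsilon> > 0\<close> by (simp add: h_def)
  ultimately show ?thesis
    by blast
qed

lemma ex_test_fun_tendsto_indicator:
  fixes \<Omega> :: "'a::euclidean_space set"
  assumes "open \<Omega>"
  obtains \<phi> D where "\<And>k::nat. test_fun \<Omega> (\<phi> k) (D k)" "\<And>k x. \<bar>\<phi> k x\<bar> \<le> 1"
    "\<And>x. (\<lambda>k. \<phi> k x) \<longlonglongrightarrow> indicator \<Omega> x"
proof (rule open_Union_compact_subsets[OF assms])
  fix C :: "nat \<Rightarrow> 'a set"
  assume exhaustion: "\<And>k. compact (C k)" "\<And>k. C k \<subseteq> \<Omega>"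
    "\<And>K. compact K \<Longrightarrow> K \<subseteq> \<Omega> \<Longrightarrow> \<exists>N. \<forall>k\<ge>N. K \<subseteq> C k"
  have "\<forall>k. \<exists>\<phi> D. test_fun \<Omega> \<phi> D \<and> (\<forall>x. 0 \<le> \<phi> x \<and> \<phi> x \<le> 1) \<and> (\<forall>x\<in>C k. \<phi> x = 1)"
    using ex_test_fun_cutoff[OF assms exhaustion(1,2)] by blast
  then obtain \<phi> D where cutoff: "\<And>k. test_fun \<Omega> (\<phi> k) (D k)" "\<And>k x. 0 \<le> \<phi> k x" "\<And>k x. \<phi> k x \<le> 1"
    "\<And>k x. x \<in> C k \<Longrightarrow> \<phi> k x = 1"
    by metis
  have "(\<lambda>k. \<phi> k x) \<longlonglongrightarrow> indicator \<Omega> x" for x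
  proof (cases "x \<in> \<Omega>")
    case True
    with exhaustion(3)[of "{x}"] have "\<forall>\<^sub>F k in sequentially. x \<in> C k"
      by (auto simp: eventually_sequentially)
    then have "\<forall>\<^sub>F k in sequentially. \<phi> k x = indicator \<Omega> x"
      by eventually_elim (simp add: cutoff(4) True)
    then show ?thesis
      by (rule tendsto_eventually)
  next
    case False
    have "\<phi> k x = 0" for k
      using test_fun_support[OF cutoff(1)[of k]] False by (metis subsetD)
    then show ?thesis
      using False by simp
  qed
  with cutoff show ?thesis
    by (intro that) auto
qed

section \<open>Integrals of test functions\<close>

lemma integrable_continuous_compact_support:
  fixes f :: "'a::euclidean_space \<Rightarrow> 'b::{banach, second_countable_topology}"
  assumes f_cont: "continuous_on UNIV f" and f_support: "compact K" "\<And>x. x \<notin> K \<Longrightarrow> f x = 0"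
    and meas_\<Omega>: "\<Omega> \<in> sets lebesgue"
  shows "integrable (lebesgue_on \<Omega>) f"
proof -
  have "integrable lborel (\<lambda>x. indicator K x *\<^sub>R f x)"
    by (rule borel_integrable_compact[OF f_support(1) continuous_on_subset[OF f_cont subset_UNIV]])
  also have "(\<lambda>x. indicator K x *\<^sub>R f x) = f"
    using f_support(2) by (auto simp: indicator_def fun_eq_iff)
  finally have "integrable lebesgue f"
    using f_cont by (simp add: integrable_completion borel_measurable_continuous_onI)
  then show ?thesis
    using meas_\<Omega> by (simp add: integrable_restrict_space integrable_mult_indicator)
qed

lemma L2_on_continuous_compact_support:
  fixes f :: "'a::euclidean_space \<Rightarrow> 'b::{banach, second_countable_topology}"
  assumes "continuous_on UNIV f" "compact K" "\<And>x. x \<notin> K \<Longrightarrow> f x = 0" "\<Omega> \<in> sets lebesgue"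
  shows "L2_on \<Omega> f"
  unfolding L2_on_def
proof
  show "f \<in> borel_measurable (lebesgue_on \<Omega>)"
    using integrable_continuous_compact_support[OF assms] by (rule borel_measurable_integrable)
  show "integrable (lebesgue_on \<Omega>) (\<lambda>x. (norm (f x))\<^sup>2)"
    by (rule integrable_continuous_compact_support[OF _ assms(2) _ assms(4)])
       (use assms in \<open>auto intro!: continuous_intros\<close>)
qed

lemma test_fun_integrable:
  assumes "test_fun \<Omega> \<phi> D" "S \<in> sets lebesgue"
  shows "integrable (lebesgue_on S) \<phi>" "integrable (lebesgue_on S) D"
  using test_fun_support[OF assms(1)] integrable_continuous_compact_support[OF _ _ _ assms(2)]
    test_fun_continuous_on[OF assms(1)]
  by metis+

lemma test_fun_L2_on:
  assumes "test_fun \<Omega> \<phi> D" "S \<in> sets lebesgue"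
  shows "L2_on S \<phi>" "L2_on S D"
  using test_fun_support[OF assms(1)] L2_on_continuous_compact_support[OF _ _ _ assms(2)]
    test_fun_continuous_on[OF assms(1)]
  by metis+

lemma ex_cbox_integral_translate:
  fixes K :: "'a::euclidean_space set"
  assumes "bounded K"
  obtains p q where "\<And>t (f :: 'a \<Rightarrow> 'b::banach). \<bar>t\<bar> < 1 \<Longrightarrow> (\<And>x. x \<notin> K \<Longrightarrow> f x = 0) \<Longrightarrow>
    integral (cbox p q) (\<lambda>x. f (x + t *\<^sub>R e)) = integral UNIV f"
proof -
  obtain R where K_bounded: "\<And>x. x \<in> K \<Longrightarrow> norm x \<le> R"
    using assms by (auto simp: bounded_iff)
  obtain p q :: 'a where ball_subset: "cball 0 (R + norm e) \<subseteq> cbox p q"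
    using bounded_subset_cbox_symmetric[OF bounded_cball] by metis
  have K_box: "K \<subseteq> cbox (p + t *\<^sub>R e) (q + t *\<^sub>R e)" if "\<bar>t\<bar> < 1" for t
  proof
    fix x assume "x \<in> K"
    have "norm (x - t *\<^sub>R e) \<le> norm x + \<bar>t\<bar> * norm e"
      using norm_triangle_ineq4[of x "t *\<^sub>R e"] by simp
    also have "\<dots> \<le> R + norm e"
      using K_bounded[OF \<open>x \<in> K\<close>] that by (intro add_mono mult_left_le_one_le) auto
    finally have "x - t *\<^sub>R e \<in> cbox p q"
      using ball_subset by (auto simp: mem_cball_0)
    then show "x \<in> cbox (p + t *\<^sub>R e) (q + t *\<^sub>R e)"
      by (simp add: mem_box inner_add_left inner_diff_left le_diff_eq diff_le_eq)
  qed
  show ?thesis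
  proof
    fix t :: real and f :: "'a \<Rightarrow> 'b"
    assume "\<bar>t\<bar> < 1" and f_zero: "\<And>x. x \<notin> K \<Longrightarrow> f x = 0"
    have "integral (cbox p q) (\<lambda>x. f (x + t *\<^sub>R e)) = integral (cbox (p + t *\<^sub>R e) (q + t *\<^sub>R e)) f"
      using integral_shift_cbox_plus[of p q f "t *\<^sub>R e"] by (simp add: o_def add.commute)
    also have "\<dots> = integral UNIV (\<lambda>x. if x \<in> cbox (p + t *\<^sub>R e) (q + t *\<^sub>R e) then f x else 0)"
      by (rule Henstock_Kurzweil_Integration.integral_restrict_UNIV[symmetric])
    also have "(\<lambda>x. if x \<in> cbox (p + t *\<^sub>R e) (q + t *\<^sub>R e) then f x else 0) = f"
      using K_box[OF \<open>\<bar>t\<bar> < 1\<close>] f_zero by (fastforce simp: fun_eq_iff)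
    finally show "integral (cbox p q) (\<lambda>x. f (x + t *\<^sub>R e)) = integral UNIV f" .
  qed
qed

text \<open>The integral of \<open>\<phi> (x + t *\<^sub>R e)\<close> over a large box does not depend on \<open>t\<close> near \<open>0\<close>;
  differentiate it under the integral sign.\<close>
lemma test_fun_integral_directional_derivative:
  fixes \<phi> :: "'a::euclidean_space \<Rightarrow> real"
  assumes test_\<phi>: "test_fun \<Omega> \<phi> D"
  shows "integral UNIV (\<lambda>x. D x \<bullet> e) = 0"
proof -
  obtain K where \<phi>_support: "compact K" "\<And>x. x \<notin> K \<Longrightarrow> \<phi> x = 0" "\<And>x. x \<notin> K \<Longrightarrow> D x = 0"
    using test_fun_support[OF test_\<phi>] by metis
  obtain p q where translate: "\<And>t (f :: 'a \<Rightarrow> real). \<bar>t\<bar> < 1 \<Longrightarrow> (\<And>x. x \<notin> K \<Longrightarrow> f x = 0) \<Longrightarrow>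
      integral (cbox p q) (\<lambda>x. f (x + t *\<^sub>R e)) = integral UNIV f"
    using ex_cbox_integral_translate[OF compact_imp_bounded[OF \<phi>_support(1)], where 'b=real] by metis
  define I where "I t = integral (cbox p q) (\<lambda>x. \<phi> (x + t *\<^sub>R e))" for t
  have "(I has_real_derivative integral (cbox p q) (\<lambda>x. D (x + 0 *\<^sub>R e) \<bullet> e)) (at 0 within {-1<..<1})"
    unfolding I_def
  proof (rule leibniz_rule_field_derivative)
    fix t x
    have "((\<lambda>t. \<phi> (x + t *\<^sub>R e)) has_derivative (\<lambda>s. D (x + t *\<^sub>R e) \<bullet> (s *\<^sub>R e))) (at t)"
      by (rule has_derivative_compose[OF _ test_fun_has_derivative[OF test_\<phi>]])
         (auto intro!: derivative_eq_intros)
    then show "((\<lambda>t. \<phi> (x + t *\<^sub>R e)) has_real_derivative D (x + t *\<^sub>R e) \<bullet> e) (at t within {-1<..<1})"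
      by (simp add: has_field_derivative_def has_derivative_at_withinI mult.commute[of _ "_ \<bullet> _"])
    show "(\<lambda>x. \<phi> (x + t *\<^sub>R e)) integrable_on cbox p q"
      by (intro integrable_continuous continuous_intros
          continuous_on_compose2[OF test_fun_continuous_on(1)[OF test_\<phi>]]) auto
  next
    show "continuous_on ({-1<..<1} \<times> cbox p q) (\<lambda>(t, x). D (x + t *\<^sub>R e) \<bullet> e)"
      unfolding split_beta
      by (intro continuous_intros continuous_on_compose2[OF test_fun_continuous_on(2)[OF test_\<phi>]]) auto
  qed auto
  then have "(I has_real_derivative integral UNIV (\<lambda>x. D x \<bullet> e)) (at 0)"
    using translate[of 0 "\<lambda>x. D x \<bullet> e"] \<phi>_support(3)
    by (simp add: at_within_open[of _ "{-1<..<1::real}"])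
  moreover have "(I has_real_derivative 0) (at 0)"
  proof (rule has_field_derivative_transform_within_open[of "\<lambda>_. integral UNIV \<phi>"])
    show "integral UNIV \<phi> = I t" if "t \<in> {-1<..<1}" for t
      using that translate[of t \<phi>] \<phi>_support(2) by (auto simp: I_def)
  qed auto
  ultimately show ?thesis
    by (rule DERIV_unique)
qed

lemma test_fun_integral_derivative:
  assumes test_\<phi>: "test_fun \<Omega> \<phi> D" and meas_\<Omega>: "\<Omega> \<in> sets lebesgue"
  shows "(\<integral>x. D x \<partial>lebesgue_on \<Omega>) = 0"
proof (rule euclidean_eqI)
  fix b :: 'a
  obtain K where \<phi>_support: "K \<subseteq> \<Omega>" "\<And>x. x \<notin> K \<Longrightarrow> D x = 0"
    using test_fun_support[OF test_\<phi>] by metis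
  note D_int = test_fun_integrable(2)[OF test_\<phi> meas_\<Omega>]
  have "(\<integral>x. D x \<partial>lebesgue_on \<Omega>) \<bullet> b = (\<integral>x. D x \<bullet> b \<partial>lebesgue_on \<Omega>)"
    using D_int by simp
  also have "\<dots> = integral \<Omega> (\<lambda>x. D x \<bullet> b)"
    using has_integral_integral_lebesgue_on[OF integrable_inner_left[where c = b, OF D_int] meas_\<Omega>]
    by (simp add: integral_unique)
  also have "\<dots> = integral UNIV (\<lambda>x. if x \<in> \<Omega> then D x \<bullet> b else 0)"
    by (rule Henstock_Kurzweil_Integration.integral_restrict_UNIV[symmetric])
  also have "(\<lambda>x. if x \<in> \<Omega> then D x \<bullet> b else 0) = (\<lambda>x. D x \<bullet> b)"
    using \<phi>_support by fastforce
  finally show "(\<integral>x. D x \<partial>lebesgue_on \<Omega>) \<bullet> b = 0 \<bullet> b"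
    by (simp add: test_fun_integral_directional_derivative[OF test_\<phi>])
qed

text \<open>Integrate the \<open>b\<close>-derivative of \<open>(x \<bullet> b) * (\<phi> x)\<^sup>2\<close>.\<close>
lemma test_fun_L2_norm_power2_eq:
  assumes test_\<phi>: "test_fun \<Omega> \<phi> D" and meas_\<Omega>: "\<Omega> \<in> sets lebesgue" and b_unit: "norm b = 1"
  shows "integrable (lebesgue_on \<Omega>) (\<lambda>x. (x \<bullet> b) * (\<phi> x * (D x \<bullet> b)))"
    "(L2_norm_on \<Omega> \<phi>)\<^sup>2 = - 2 * (\<integral>x. (x \<bullet> b) * (\<phi> x * (D x \<bullet> b)) \<partial>lebesgue_on \<Omega>)"
proof -
  let ?E = "\<lambda>x. (x \<bullet> b) *\<^sub>R (\<phi> x *\<^sub>R D x + \<phi> x *\<^sub>R D x) + (\<phi> x * \<phi> x) *\<^sub>R b"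
  have test_E: "test_fun \<Omega> (\<lambda>x. (x \<bullet> b) * (\<phi> x * \<phi> x)) ?E"
    by (rule test_fun_mult_C1[OF test_fun_mult[OF test_\<phi> test_\<phi>]])
       (auto intro!: derivative_eq_intros simp: inner_commute)
  obtain K where \<phi>_support: "compact K" "\<And>x. x \<notin> K \<Longrightarrow> \<phi> x = 0"
    using test_fun_support[OF test_\<phi>] by metis
  show product_int: "integrable (lebesgue_on \<Omega>) (\<lambda>x. (x \<bullet> b) * (\<phi> x * (D x \<bullet> b)))"
    by (rule integrable_continuous_compact_support[OF _ \<phi>_support(1) _ meas_\<Omega>])
       (use \<phi>_support(2) in \<open>auto intro!: continuous_intros test_fun_continuous_on[OF test_\<phi>]\<close>)
  have power2_int: "integrable (lebesgue_on \<Omega>) (\<lambda>x. (norm (\<phi> x))\<^sup>2)"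
    by (rule L2_on_power2_norm_integrable[OF test_fun_L2_on(1)[OF test_\<phi> meas_\<Omega>]])
  have E_inner_b: "?E x \<bullet> b = 2 * ((x \<bullet> b) * (\<phi> x * (D x \<bullet> b))) + (norm (\<phi> x))\<^sup>2" for x
    using b_unit by (simp add: norm_eq_1 power2_eq_square inner_add_left algebra_simps)
  have "(\<integral>x. ?E x \<bullet> b \<partial>lebesgue_on \<Omega>) = 0"
    using test_fun_integral_derivative[OF test_E meas_\<Omega>] test_fun_integrable(2)[OF test_E meas_\<Omega>] by simp
  then show "(L2_norm_on \<Omega> \<phi>)\<^sup>2 = - 2 * (\<integral>x. (x \<bullet> b) * (\<phi> x * (D x \<bullet> b)) \<partial>lebesgue_on \<Omega>)"
    unfolding E_inner_b L2_norm_on_power2 using product_int power2_int by (simp del: real_norm_def)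
qed

lemma test_fun_Poincare:
  fixes \<Omega> :: "'a::euclidean_space set"
  assumes test_\<phi>: "test_fun \<Omega> \<phi> D" and meas_\<Omega>: "\<Omega> \<in> sets lebesgue" and "\<Omega> \<subseteq> cball 0 R" "0 \<le> R"
  shows "L2_norm_on \<Omega> \<phi> \<le> 2 * R * L2_norm_on \<Omega> D"
proof -
  obtain b :: 'a where b_Basis: "b \<in> Basis"
    using nonempty_Basis by blast
  note \<phi>_L2 = test_fun_L2_on[OF test_\<phi> meas_\<Omega>]
    and product_int = test_fun_L2_norm_power2_eq(1)[OF test_\<phi> meas_\<Omega> norm_Basis[OF b_Basis]]
  have "(L2_norm_on \<Omega> \<phi>)\<^sup>2 = 2 * (\<integral>x. - ((x \<bullet> b) * (\<phi> x * (D x \<bullet> b))) \<partial>lebesgue_on \<Omega>)"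
    unfolding test_fun_L2_norm_power2_eq(2)[OF test_\<phi> meas_\<Omega> norm_Basis[OF b_Basis]] by simp
  also have "(\<integral>x. - ((x \<bullet> b) * (\<phi> x * (D x \<bullet> b))) \<partial>lebesgue_on \<Omega>)
      \<le> (\<integral>x. R * (norm (\<phi> x) * norm (D x)) \<partial>lebesgue_on \<Omega>)"
  proof (rule integral_mono)
    fix x assume "x \<in> space (lebesgue_on \<Omega>)"
    then have "\<bar>x \<bullet> b\<bar> \<le> R" "\<bar>D x \<bullet> b\<bar> \<le> norm (D x)"
      using \<open>\<Omega> \<subseteq> cball 0 R\<close> Basis_le_norm[OF b_Basis, of x] Basis_le_norm[OF b_Basis, of "D x"] by auto
    then have "\<bar>x \<bullet> b\<bar> * (\<bar>\<phi> x\<bar> * \<bar>D x \<bullet> b\<bar>) \<le> R * (\<bar>\<phi> x\<bar> * norm (D x))"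
      using \<open>0 \<le> R\<close> by (intro mult_mono) auto
    then have "\<bar>(x \<bullet> b) * (\<phi> x * (D x \<bullet> b))\<bar> \<le> R * (norm (\<phi> x) * norm (D x))"
      by (simp add: abs_mult)
    then show "- ((x \<bullet> b) * (\<phi> x * (D x \<bullet> b))) \<le> R * (norm (\<phi> x) * norm (D x))"
      by (rule abs_le_D2)
  qed (use product_int L2_on_norm_mult_integrable[OF \<phi>_L2] in auto)
  also have "\<dots> \<le> R * (L2_norm_on \<Omega> \<phi> * L2_norm_on \<Omega> D)"
    using mult_left_mono[OF L2_Cauchy_Schwarz[OF \<phi>_L2] \<open>0 \<le> R\<close>] by simp
  finally have "L2_norm_on \<Omega> \<phi> * L2_norm_on \<Omega> \<phi> \<le> L2_norm_on \<Omega> \<phi> * (2 * R * L2_norm_on \<Omega> D)"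
    by (simp add: power2_eq_square mult_ac)
  then show ?thesis
    using \<open>0 \<le> R\<close> L2_norm_on_nonneg[of \<Omega> \<phi>] L2_norm_on_nonneg[of \<Omega> D]
    by (cases "L2_norm_on \<Omega> \<phi> = 0") (auto simp: mult_le_cancel_left)
qed

section \<open>The fundamental lemma of the calculus of variations\<close>

lemma borel_measurable_indicator_scaleR_lebesgue_on:
  fixes f :: "'a::euclidean_space \<Rightarrow> 'b::{banach, second_countable_topology}"
  assumes "S \<in> sets lebesgue" "f \<in> borel_measurable (lebesgue_on \<Omega>)"
  shows "(\<lambda>x. indicator S x *\<^sub>R f x) \<in> borel_measurable (lebesgue_on \<Omega>)"
  by (rule borel_measurable_scaleR
      [OF measurable_restrict_space1[OF borel_measurable_indicator[OF assms(1)]] assms(2)])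

lemma test_fun_orthogonal_imp_integral_open_zero:
  fixes f :: "'a::euclidean_space \<Rightarrow> 'b::{banach, second_countable_topology}"
  assumes f_int: "integrable (lebesgue_on \<Omega>) f"
    and orth: "\<And>\<phi> D. test_fun \<Omega> \<phi> D \<Longrightarrow> (\<integral>x. \<phi> x *\<^sub>R f x \<partial>lebesgue_on \<Omega>) = 0"
    and U_open_subset: "open U" "U \<subseteq> \<Omega>"
  shows "(\<integral>x. indicator U x *\<^sub>R f x \<partial>lebesgue_on \<Omega>) = 0"
proof -
  obtain \<phi> D where test_\<phi>: "\<And>k::nat. test_fun U (\<phi> k) (D k)" and \<phi>_le_1: "\<And>k x. \<bar>\<phi> k x\<bar> \<le> 1"
    and \<phi>_lim: "\<And>x. (\<lambda>k. \<phi> k x) \<longlonglongrightarrow> indicator U x"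
    using ex_test_fun_tendsto_indicator[OF U_open_subset(1)] by metis
  have f_meas: "f \<in> borel_measurable (lebesgue_on \<Omega>)"
    using f_int by (rule borel_measurable_integrable)
  have "(\<lambda>k. \<integral>x. \<phi> k x *\<^sub>R f x \<partial>lebesgue_on \<Omega>) \<longlonglongrightarrow> (\<integral>x. indicator U x *\<^sub>R f x \<partial>lebesgue_on \<Omega>)"
  proof (rule integral_dominated_convergence)
    show "integrable (lebesgue_on \<Omega>) (\<lambda>x. norm (f x))"
      using f_int by simp
    have "\<phi> k \<in> borel_measurable (lebesgue_on \<Omega>)" for k
      using borel_measurable_continuous_onI[OF test_fun_continuous_on(1)[OF test_\<phi>]]
      by (simp add: measurable_completion measurable_restrict_space1)
    then show "(\<lambda>x. \<phi> k x *\<^sub>R f x) \<in> borel_measurable (lebesgue_on \<Omega>)" for k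
      using f_meas by (rule borel_measurable_scaleR)
    show "(\<lambda>x. indicator U x *\<^sub>R f x) \<in> borel_measurable (lebesgue_on \<Omega>)"
      using U_open_subset(1) f_meas by (intro borel_measurable_indicator_scaleR_lebesgue_on) simp_all
    show "AE x in lebesgue_on \<Omega>. (\<lambda>k. \<phi> k x *\<^sub>R f x) \<longlonglongrightarrow> indicator U x *\<^sub>R f x"
      by (intro AE_I2 tendsto_scaleR \<phi>_lim tendsto_const)
    show "AE x in lebesgue_on \<Omega>. norm (\<phi> k x *\<^sub>R f x) \<le> norm (f x)" for k
      using \<phi>_le_1 by (auto intro!: AE_I2 mult_left_le_one_le)
  qed
  then show ?thesis
    by (simp add: orth[OF test_fun_mono[OF test_\<phi> U_open_subset(2)]] LIMSEQ_const_iff)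
qed

lemma test_fun_orthogonal_imp_integral_gdelta_zero:
  fixes f :: "'a::euclidean_space \<Rightarrow> 'b::{banach, second_countable_topology}"
  assumes open_\<Omega>: "open \<Omega>" and f_int: "integrable (lebesgue_on \<Omega>) f"
    and orth: "\<And>\<phi> D. test_fun \<Omega> \<phi> D \<Longrightarrow> (\<integral>x. \<phi> x *\<^sub>R f x \<partial>lebesgue_on \<Omega>) = 0"
    and "gdelta S"
  shows "(\<integral>x. indicator S x *\<^sub>R f x \<partial>lebesgue_on \<Omega>) = 0"
proof -
  let ?M = "lebesgue_on \<Omega>"
  from \<open>gdelta S\<close> obtain F :: "nat \<Rightarrow> 'a set" where open_F: "\<And>i. open (F i)" and S_eq: "S = (\<Inter>i. F i)"
    by cases (rule that)
  define U where "U k = \<Omega> \<inter> (\<Inter>i<k. F i)" for k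
  have U_open_subset: "open (U k)" "U k \<subseteq> \<Omega>" for k
    using open_\<Omega> open_F by (auto simp: U_def)
  have "(\<lambda>k. \<integral>x. indicator (U k) x *\<^sub>R f x \<partial>?M) \<longlonglongrightarrow> (\<integral>x. indicator S x *\<^sub>R f x \<partial>?M)"
  proof (rule integral_dominated_convergence)
    show "integrable ?M (\<lambda>x. norm (f x))"
      using f_int by simp
    show "(\<lambda>x. indicator (U k) x *\<^sub>R f x) \<in> borel_measurable ?M" for k
      using U_open_subset(1) f_int by (intro borel_measurable_indicator_scaleR_lebesgue_on) auto
    have "S \<in> sets lebesgue"
      unfolding S_eq using open_F by (intro sets.countable_INT) auto
    then show "(\<lambda>x. indicator S x *\<^sub>R f x) \<in> borel_measurable ?M"
      using f_int by (intro borel_measurable_indicator_scaleR_lebesgue_on) auto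
    have "(\<lambda>k. indicator (U k) x *\<^sub>R f x) \<longlonglongrightarrow> indicator S x *\<^sub>R f x" if "x \<in> \<Omega>" for x
      using tendsto_scaleR[OF LIMSEQ_indicator_INT[of F x] tendsto_const[of "f x"]] that
      by (simp add: U_def S_eq indicator_inter_arith)
    then show "AE x in ?M. (\<lambda>k. indicator (U k) x *\<^sub>R f x) \<longlonglongrightarrow> indicator S x *\<^sub>R f x"
      by (intro AE_I2) simp
    show "AE x in ?M. norm (indicator (U k) x *\<^sub>R f x) \<le> norm (f x)" for k
      by (auto intro!: AE_I2 mult_left_le_one_le)
  qed
  then show ?thesis
    by (simp add: LIMSEQ_const_iff
        test_fun_orthogonal_imp_integral_open_zero[OF f_int orth U_open_subset])
qed

lemma test_fun_orthogonal_imp_AE_zero_integrable: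
  fixes f :: "'a::euclidean_space \<Rightarrow> 'b::{banach, second_countable_topology}"
  assumes open_\<Omega>: "open \<Omega>" and f_int: "integrable (lebesgue_on \<Omega>) f"
    and orth: "\<And>\<phi> D. test_fun \<Omega> \<phi> D \<Longrightarrow> (\<integral>x. \<phi> x *\<^sub>R f x \<partial>lebesgue_on \<Omega>) = 0"
  shows "AE x in lebesgue_on \<Omega>. f x = 0"
proof -
  interpret sigma_finite_measure "lebesgue_on \<Omega>"
    using open_\<Omega> by (intro sigma_finite_lebesgue_on) simp
  show ?thesis
  proof (rule density_zero[OF f_int])
    fix A assume "A \<in> sets (lebesgue_on \<Omega>)"
    then have "A \<in> sets lebesgue"
      using open_\<Omega> by (auto simp: sets_restrict_space)
    then obtain S T where "gdelta S" and T_null: "T \<in> null_sets lebesgue" and S_eq: "A \<union> T = S"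
      using lebesgue_set_almost_gdelta by metis
    have T_null_\<Omega>: "AE x in lebesgue_on \<Omega>. x \<notin> T"
      using AE_not_in[OF T_null] open_\<Omega> by (subst AE_restrict_space_iff) auto
    have f_meas: "f \<in> borel_measurable (lebesgue_on \<Omega>)"
      using f_int by (rule borel_measurable_integrable)
    have "set_lebesgue_integral (lebesgue_on \<Omega>) A f = (\<integral>x. indicator S x *\<^sub>R f x \<partial>lebesgue_on \<Omega>)"
      unfolding set_lebesgue_integral_def
    proof (rule integral_cong_AE)
      show "AE x in lebesgue_on \<Omega>. indicator A x *\<^sub>R f x = indicator S x *\<^sub>R f x"
        using T_null_\<Omega> by eventually_elim (use S_eq in \<open>auto simp: indicator_def\<close>)
    qed (use \<open>A \<in> sets lebesgue\<close> T_null S_eq f_meas in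
        \<open>auto intro!: borel_measurable_indicator_scaleR_lebesgue_on\<close>)
    also have "\<dots> = 0"
      using open_\<Omega> f_int orth \<open>gdelta S\<close> by (rule test_fun_orthogonal_imp_integral_gdelta_zero)
    finally show "set_lebesgue_integral (lebesgue_on \<Omega>) A f = 0" .
  qed
qed

lemma test_fun_orthogonal_imp_AE_zero:
  fixes f :: "'a::euclidean_space \<Rightarrow> 'b::{banach, second_countable_topology}"
  assumes open_\<Omega>: "open \<Omega>"
    and \<phi>f_int: "\<And>\<phi> D. test_fun \<Omega> \<phi> D \<Longrightarrow> integrable (lebesgue_on \<Omega>) (\<lambda>x. \<phi> x *\<^sub>R f x)"
    and orth: "\<And>\<phi> D. test_fun \<Omega> \<phi> D \<Longrightarrow> (\<integral>x. \<phi> x *\<^sub>R f x \<partial>lebesgue_on \<Omega>) = 0"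
  shows "AE x in lebesgue_on \<Omega>. f x = 0"
proof -
  obtain \<phi> D where \<phi>_indicator: "\<And>k::nat. test_fun \<Omega> (\<phi> k) (D k)" "\<And>x. (\<lambda>k. \<phi> k x) \<longlonglongrightarrow> indicator \<Omega> x"
    using ex_test_fun_tendsto_indicator[OF open_\<Omega>] by metis
  have "AE x in lebesgue_on \<Omega>. \<phi> k x *\<^sub>R f x = 0" for k
  proof (rule test_fun_orthogonal_imp_AE_zero_integrable[OF open_\<Omega> \<phi>f_int[OF \<phi>_indicator(1)]])
    show "(\<integral>x. \<psi> x *\<^sub>R (\<phi> k x *\<^sub>R f x) \<partial>lebesgue_on \<Omega>) = 0" if "test_fun \<Omega> \<psi> E" for \<psi> E
      using orth[OF test_fun_mult[OF that \<phi>_indicator(1)]] by simp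
  qed
  then have "AE x in lebesgue_on \<Omega>. \<forall>k. \<phi> k x *\<^sub>R f x = 0"
    unfolding AE_all_countable by blast
  with AE_space show ?thesis
  proof eventually_elim
    case (elim x)
    have "(\<lambda>k. \<phi> k x *\<^sub>R f x) \<longlonglongrightarrow> indicator \<Omega> x *\<^sub>R f x"
      by (intro tendsto_scaleR \<phi>_indicator(2) tendsto_const)
    with elim show ?case
      by (auto simp: LIMSEQ_const_iff)
  qed
qed

section \<open>Weak gradients\<close>

lemma weak_gradD:
  "weak_grad \<Omega> u G \<Longrightarrow> test_fun \<Omega> \<phi> D \<Longrightarrow>
    (\<integral>x. u x *\<^sub>R D x \<partial>lebesgue_on \<Omega>) = - (\<integral>x. \<phi> x *\<^sub>R G x \<partial>lebesgue_on \<Omega>)"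
  by (simp add: weak_grad_def)

lemma weak_grad_AE_unique:
  assumes open_\<Omega>: "open \<Omega>" and G_grad: "L2_on \<Omega> G" "weak_grad \<Omega> u G"
    and H_grad: "L2_on \<Omega> H" "weak_grad \<Omega> u H"
  shows "AE x in lebesgue_on \<Omega>. G x = H x"
proof -
  have test_L2: "L2_on \<Omega> \<phi>" if "test_fun \<Omega> \<phi> D" for \<phi> D
    using test_fun_L2_on(1)[OF that] open_\<Omega> by simp
  have "AE x in lebesgue_on \<Omega>. G x - H x = 0"
  proof (rule test_fun_orthogonal_imp_AE_zero[OF open_\<Omega>])
    fix \<phi> D assume test_\<phi>: "test_fun \<Omega> \<phi> D"
    show "integrable (lebesgue_on \<Omega>) (\<lambda>x. \<phi> x *\<^sub>R (G x - H x))"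
      by (intro L2_on_scaleR_integrable test_L2[OF test_\<phi>] L2_on_diff G_grad H_grad)
    show "(\<integral>x. \<phi> x *\<^sub>R (G x - H x) \<partial>lebesgue_on \<Omega>) = 0"
      using weak_gradD[OF G_grad(2) test_\<phi>] weak_gradD[OF H_grad(2) test_\<phi>]
      by (simp add: scaleR_diff_right L2_on_scaleR_integrable test_L2[OF test_\<phi>] G_grad H_grad)
  qed
  then show ?thesis
    by simp
qed

lemma weak_grad_lincomb:
  assumes meas_\<Omega>: "\<Omega> \<in> sets lebesgue" and uv_L2: "L2_on \<Omega> u" "L2_on \<Omega> v" "L2_on \<Omega> G" "L2_on \<Omega> H"
    and grad_uv: "weak_grad \<Omega> u G" "weak_grad \<Omega> v H"
  shows "weak_grad \<Omega> (\<lambda>x. u x + c * v x) (\<lambda>x. G x + c *\<^sub>R H x)"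
  unfolding weak_grad_def
proof (intro allI impI)
  fix \<phi> D assume test_\<phi>: "test_fun \<Omega> \<phi> D"
  note \<phi>_L2 = test_fun_L2_on[OF test_\<phi> meas_\<Omega>]
  have "(\<integral>x. (u x + c * v x) *\<^sub>R D x \<partial>lebesgue_on \<Omega>)
      = (\<integral>x. u x *\<^sub>R D x \<partial>lebesgue_on \<Omega>) + c *\<^sub>R (\<integral>x. v x *\<^sub>R D x \<partial>lebesgue_on \<Omega>)"
    using uv_L2 \<phi>_L2 by (simp add: scaleR_add_left L2_on_scaleR_integrable flip: scaleR_scaleR)
  also have "\<dots> = - (\<integral>x. \<phi> x *\<^sub>R (G x + c *\<^sub>R H x) \<partial>lebesgue_on \<Omega>)"
  proof -
    have "\<phi> x *\<^sub>R (G x + c *\<^sub>R H x) = \<phi> x *\<^sub>R G x + c *\<^sub>R (\<phi> x *\<^sub>R H x)" for x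
      by (simp add: scaleR_add_right)
    then show ?thesis
      using uv_L2 \<phi>_L2
      by (simp add: weak_gradD[OF grad_uv(1) test_\<phi>] weak_gradD[OF grad_uv(2) test_\<phi>]
          L2_on_scaleR_integrable del: scaleR_scaleR)
  qed
  finally show "(\<integral>x. (u x + c * v x) *\<^sub>R D x \<partial>lebesgue_on \<Omega>)
      = - (\<integral>x. \<phi> x *\<^sub>R (G x + c *\<^sub>R H x) \<partial>lebesgue_on \<Omega>)" .
qed

lemma weak_grad_L2_closed:
  assumes meas_\<Omega>: "\<Omega> \<in> sets lebesgue" and grad_u: "\<And>k. weak_grad \<Omega> (u k) (G k)"
    and uG_lim: "L2_tendsto \<Omega> u v" "L2_tendsto \<Omega> G H"
  shows "weak_grad \<Omega> v H"
  unfolding weak_grad_def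
proof (intro allI impI)
  fix \<phi> D assume test_\<phi>: "test_fun \<Omega> \<phi> D"
  note \<phi>_const_lim = test_fun_L2_on[OF test_\<phi> meas_\<Omega>, THEN L2_tendsto_const]
  have "(\<lambda>k. \<integral>x. u k x *\<^sub>R D x \<partial>lebesgue_on \<Omega>) \<longlonglongrightarrow> (\<integral>x. v x *\<^sub>R D x \<partial>lebesgue_on \<Omega>)"
    by (rule L2_tendsto_integral_bounded_bilinear[OF bounded_bilinear_scaleR uG_lim(1) \<phi>_const_lim(2)])
  moreover have "(\<lambda>k. \<integral>x. u k x *\<^sub>R D x \<partial>lebesgue_on \<Omega>) \<longlonglongrightarrow> - (\<integral>x. \<phi> x *\<^sub>R H x \<partial>lebesgue_on \<Omega>)"
    unfolding weak_gradD[OF grad_u test_\<phi>]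
    by (intro tendsto_minus
        L2_tendsto_integral_bounded_bilinear[OF bounded_bilinear_scaleR \<phi>_const_lim(1) uG_lim(2)])
  ultimately show "(\<integral>x. v x *\<^sub>R D x \<partial>lebesgue_on \<Omega>) = - (\<integral>x. \<phi> x *\<^sub>R H x \<partial>lebesgue_on \<Omega>)"
    by (rule LIMSEQ_unique)
qed

lemma test_fun_weak_grad:
  assumes meas_\<Omega>: "\<Omega> \<in> sets lebesgue" and test_\<phi>: "test_fun \<Omega> \<phi> D"
  shows "weak_grad \<Omega> \<phi> D"
  unfolding weak_grad_def
proof (intro allI impI)
  fix \<psi> E assume test_\<psi>: "test_fun \<Omega> \<psi> E"
  have "(\<integral>x. \<phi> x *\<^sub>R E x + \<psi> x *\<^sub>R D x \<partial>lebesgue_on \<Omega>) = 0"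
    by (rule test_fun_integral_derivative[OF test_fun_mult[OF test_\<phi> test_\<psi>] meas_\<Omega>])
  then show "(\<integral>x. \<phi> x *\<^sub>R E x \<partial>lebesgue_on \<Omega>) = - (\<integral>x. \<psi> x *\<^sub>R D x \<partial>lebesgue_on \<Omega>)"
    using test_fun_L2_on[OF test_\<phi> meas_\<Omega>] test_fun_L2_on[OF test_\<psi> meas_\<Omega>]
    by (simp add: L2_on_scaleR_integrable eq_neg_iff_add_eq_0)
qed

section \<open>Sobolev functions\<close>

lemma H1_grad:
  assumes "H1 \<Omega> u"
  shows "L2_on \<Omega> u" "L2_on \<Omega> (grad \<Omega> u)" "weak_grad \<Omega> u (grad \<Omega> u)"
proof -
  have "\<exists>G. L2_on \<Omega> G \<and> weak_grad \<Omega> u G"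
    using assms by (simp add: H1_def)
  from someI_ex[OF this] show "L2_on \<Omega> (grad \<Omega> u)" "weak_grad \<Omega> u (grad \<Omega> u)"
    by (simp_all add: grad_def)
qed (use assms in \<open>simp add: H1_def\<close>)

lemma H1I:
  assumes open_\<Omega>: "open \<Omega>" and "L2_on \<Omega> u" "L2_on \<Omega> G" "weak_grad \<Omega> u G"
  shows "H1 \<Omega> u" "AE x in lebesgue_on \<Omega>. grad \<Omega> u x = G x"
proof -
  show "H1 \<Omega> u"
    using assms by (auto simp: H1_def)
  from weak_grad_AE_unique[OF open_\<Omega> H1_grad(2,3)[OF this] assms(3,4)]
  show "AE x in lebesgue_on \<Omega>. grad \<Omega> u x = G x" .
qed

lemma H1_lincomb:
  assumes open_\<Omega>: "open \<Omega>" and H1_u: "H1 \<Omega> u" and H1_v: "H1 \<Omega> v"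
  shows "H1 \<Omega> (\<lambda>x. u x + c * v x)"
    "AE x in lebesgue_on \<Omega>. grad \<Omega> (\<lambda>x. u x + c * v x) x = grad \<Omega> u x + c *\<^sub>R grad \<Omega> v x"
proof -
  note uv_L2 = H1_grad(1)[OF H1_u] H1_grad(1)[OF H1_v] H1_grad(2)[OF H1_u] H1_grad(2)[OF H1_v]
  have "weak_grad \<Omega> (\<lambda>x. u x + c * v x) (\<lambda>x. grad \<Omega> u x + c *\<^sub>R grad \<Omega> v x)"
    by (rule weak_grad_lincomb[OF _ uv_L2 H1_grad(3)[OF H1_u] H1_grad(3)[OF H1_v]]) (use open_\<Omega> in simp)
  moreover have "L2_on \<Omega> (\<lambda>x. u x + c * v x)" "L2_on \<Omega> (\<lambda>x. grad \<Omega> u x + c *\<^sub>R grad \<Omega> v x)"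
    using L2_on_scaleR[OF uv_L2(2), of c] uv_L2 by (simp_all add: L2_on_add L2_on_scaleR)
  ultimately show "H1 \<Omega> (\<lambda>x. u x + c * v x)"
    "AE x in lebesgue_on \<Omega>. grad \<Omega> (\<lambda>x. u x + c * v x) x = grad \<Omega> u x + c *\<^sub>R grad \<Omega> v x"
    using H1I[OF open_\<Omega>] by blast+
qed

lemma H1_add:
  assumes "open \<Omega>" "H1 \<Omega> u" "H1 \<Omega> v"
  shows "H1 \<Omega> (\<lambda>x. u x + v x)"
    "AE x in lebesgue_on \<Omega>. grad \<Omega> (\<lambda>x. u x + v x) x = grad \<Omega> u x + grad \<Omega> v x"
  using H1_lincomb[OF assms, of 1] by simp_all

lemma H1_diff:
  assumes "open \<Omega>" "H1 \<Omega> u" "H1 \<Omega> v"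
  shows "H1 \<Omega> (\<lambda>x. u x - v x)"
    "AE x in lebesgue_on \<Omega>. grad \<Omega> (\<lambda>x. u x - v x) x = grad \<Omega> u x - grad \<Omega> v x"
  using H1_lincomb[OF assms, of "-1"] by simp_all

lemma H1_0_imp_H1: "H1_0 \<Omega> u \<Longrightarrow> H1 \<Omega> u"
  by (simp add: H1_0_def)

lemma H1_0_approximation:
  assumes meas_\<Omega>: "\<Omega> \<in> sets lebesgue" and H1_0_u: "H1_0 \<Omega> u"
  obtains \<phi> D where "\<And>k. test_fun \<Omega> (\<phi> k) (D k)" "L2_tendsto \<Omega> \<phi> u" "L2_tendsto \<Omega> D (grad \<Omega> u)"
proof -
  obtain \<phi> D where test_\<phi>: "\<And>k. test_fun \<Omega> (\<phi> k) (D k)"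
    and sum_lim: "(\<lambda>k. (\<integral>x. (norm (u x - \<phi> k x))\<^sup>2 \<partial>lebesgue_on \<Omega>)
      + (\<integral>x. (norm (grad \<Omega> u x - D k x))\<^sup>2 \<partial>lebesgue_on \<Omega>)) \<longlonglongrightarrow> 0"
    using H1_0_u by (auto simp: H1_0_def)
  note \<phi>_L2 = test_fun_L2_on[OF test_\<phi> meas_\<Omega>] and u_L2 = H1_grad[OF H1_0_imp_H1[OF H1_0_u]]
  have "(\<lambda>k. \<integral>x. (norm (u x - \<phi> k x))\<^sup>2 \<partial>lebesgue_on \<Omega>) \<longlonglongrightarrow> 0"
    by (rule tendsto_sandwich[OF _ _ tendsto_const sum_lim]) (simp_all add: always_eventually)
  then have "L2_tendsto \<Omega> \<phi> u"
    by (simp only: L2_tendsto_power2 \<phi>_L2 u_L2)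
  moreover have "(\<lambda>k. \<integral>x. (norm (grad \<Omega> u x - D k x))\<^sup>2 \<partial>lebesgue_on \<Omega>) \<longlonglongrightarrow> 0"
    by (rule tendsto_sandwich[OF _ _ tendsto_const sum_lim]) (simp_all add: always_eventually)
  then have "L2_tendsto \<Omega> D (grad \<Omega> u)"
    by (simp only: L2_tendsto_power2 \<phi>_L2 u_L2)
  ultimately show ?thesis
    using test_\<phi> by (intro that)
qed

lemma H1_0I:
  assumes open_\<Omega>: "open \<Omega>" and test_\<phi>: "\<And>k. test_fun \<Omega> (\<phi> k) (D k)"
    and \<phi>_lim: "L2_tendsto \<Omega> \<phi> u" "L2_tendsto \<Omega> D G"
  shows "H1_0 \<Omega> u" "AE x in lebesgue_on \<Omega>. grad \<Omega> u x = G x"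
proof -
  have meas_\<Omega>: "\<Omega> \<in> sets lebesgue"
    using open_\<Omega> by simp
  note \<phi>_L2 = L2_tendsto_imp_L2_on[OF \<phi>_lim(1)] L2_tendsto_imp_L2_on[OF \<phi>_lim(2)]
  have "weak_grad \<Omega> u G"
    by (rule weak_grad_L2_closed[OF meas_\<Omega> test_fun_weak_grad[OF meas_\<Omega> test_\<phi>] \<phi>_lim])
  note H1_u = H1I[OF open_\<Omega> \<phi>_L2(2,4) this]
  show "AE x in lebesgue_on \<Omega>. grad \<Omega> u x = G x"
    by (rule H1_u(2))
  have "(\<integral>x. (norm (grad \<Omega> u x - D k x))\<^sup>2 \<partial>lebesgue_on \<Omega>)
      = (\<integral>x. (norm (G x - D k x))\<^sup>2 \<partial>lebesgue_on \<Omega>)" for k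
    using H1_u(2) L2_on_measurable[OF H1_grad(2)[OF H1_u(1)]] L2_on_measurable[OF \<phi>_L2(3)]
      L2_on_measurable[OF \<phi>_L2(4)]
    by (intro integral_cong_AE) auto
  moreover have "(\<lambda>k. (\<integral>x. (norm (u x - \<phi> k x))\<^sup>2 \<partial>lebesgue_on \<Omega>)
      + (\<integral>x. (norm (G x - D k x))\<^sup>2 \<partial>lebesgue_on \<Omega>)) \<longlonglongrightarrow> 0"
    using \<phi>_lim \<phi>_L2 by (intro tendsto_add_zero) (simp_all only: L2_tendsto_power2)
  ultimately show "H1_0 \<Omega> u"
    unfolding H1_0_def using H1_u(1) test_\<phi> by (intro conjI exI[of _ \<phi>] exI[of _ D]) auto
qed

lemma H1_0_diff:
  assumes open_\<Omega>: "open \<Omega>" and "H1_0 \<Omega> u" "H1_0 \<Omega> v"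
  shows "H1_0 \<Omega> (\<lambda>x. u x - v x)"
proof -
  have meas_\<Omega>: "\<Omega> \<in> sets lebesgue"
    using open_\<Omega> by simp
  obtain \<phi> D where u_approx: "\<And>k. test_fun \<Omega> (\<phi> k) (D k)" "L2_tendsto \<Omega> \<phi> u" "L2_tendsto \<Omega> D (grad \<Omega> u)"
    using H1_0_approximation[OF meas_\<Omega> assms(2)] by metis
  obtain \<psi> E where v_approx: "\<And>k. test_fun \<Omega> (\<psi> k) (E k)" "L2_tendsto \<Omega> \<psi> v" "L2_tendsto \<Omega> E (grad \<Omega> v)"
    using H1_0_approximation[OF meas_\<Omega> assms(3)] by metis
  show ?thesis
    by (rule H1_0I(1)[OF open_\<Omega> test_fun_diff[OF u_approx(1) v_approx(1)]
          L2_tendsto_diff[OF u_approx(2) v_approx(2)] L2_tendsto_diff[OF u_approx(3) v_approx(3)]])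
qed

lemma test_fun_H1_0:
  assumes open_\<Omega>: "open \<Omega>" and test_\<phi>: "test_fun \<Omega> \<phi> D"
  shows "H1_0 \<Omega> \<phi>" "AE x in lebesgue_on \<Omega>. grad \<Omega> \<phi> x = D x"
proof -
  have "\<Omega> \<in> sets lebesgue"
    using open_\<Omega> by simp
  note \<phi>_lim = test_fun_L2_on[OF test_\<phi> this, THEN L2_tendsto_const]
  show "H1_0 \<Omega> \<phi>" "AE x in lebesgue_on \<Omega>. grad \<Omega> \<phi> x = D x"
    by (rule H1_0I[OF open_\<Omega> test_\<phi> \<phi>_lim])+
qed

lemma div_free_orthogonal_H1_0:
  assumes meas_\<Omega>: "\<Omega> \<in> sets lebesgue" and g_div_free: "L2_on \<Omega> g" "div_free \<Omega> g" and H1_0_v: "H1_0 \<Omega> v"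
  shows "(\<integral>x. g x \<bullet> grad \<Omega> v x \<partial>lebesgue_on \<Omega>) = 0"
proof -
  obtain \<phi> D where v_approx: "\<And>k. test_fun \<Omega> (\<phi> k) (D k)" "L2_tendsto \<Omega> D (grad \<Omega> v)"
    using H1_0_approximation[OF meas_\<Omega> H1_0_v] by metis
  have "(\<lambda>k. \<integral>x. g x \<bullet> D k x \<partial>lebesgue_on \<Omega>) \<longlonglongrightarrow> (\<integral>x. g x \<bullet> grad \<Omega> v x \<partial>lebesgue_on \<Omega>)"
    by (rule L2_tendsto_integral_bounded_bilinear[OF bounded_bilinear_inner
          L2_tendsto_const[OF g_div_free(1)] v_approx(2)])
  moreover have "(\<integral>x. g x \<bullet> D k x \<partial>lebesgue_on \<Omega>) = 0" for k
    using g_div_free(2) v_approx(1) by (auto simp: div_free_def)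
  ultimately show ?thesis
    by (simp add: LIMSEQ_const_iff)
qed

lemma div_free_cong_AE:
  assumes meas_\<Omega>: "\<Omega> \<in> sets lebesgue"
    and vw_meas: "v \<in> borel_measurable (lebesgue_on \<Omega>)" "w \<in> borel_measurable (lebesgue_on \<Omega>)"
    and vw_eq: "AE x in lebesgue_on \<Omega>. v x = w x" and "div_free \<Omega> v"
  shows "div_free \<Omega> w"
  unfolding div_free_def
proof (intro allI impI)
  fix \<phi> D assume test_\<phi>: "test_fun \<Omega> \<phi> D"
  have "(\<integral>x. w x \<bullet> D x \<partial>lebesgue_on \<Omega>) = (\<integral>x. v x \<bullet> D x \<partial>lebesgue_on \<Omega>)"
    using vw_meas vw_eq L2_on_measurable[OF test_fun_L2_on(2)[OF test_\<phi> meas_\<Omega>]]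
    by (intro integral_cong_AE) auto
  also have "\<dots> = 0"
    using \<open>div_free \<Omega> v\<close> test_\<phi> by (simp add: div_free_def)
  finally show "(\<integral>x. w x \<bullet> D x \<partial>lebesgue_on \<Omega>) = 0" .
qed

section \<open>The Dirichlet problem\<close>

lemma is_sol_iff_div_free:
  assumes open_\<Omega>: "open \<Omega>" and a_Linf: "Linf_on \<Omega> a"
  shows "is_sol \<Omega> a F u \<longleftrightarrow> H1 \<Omega> u \<and> H1_0 \<Omega> (\<lambda>x. u x - F x) \<and> div_free \<Omega> (\<lambda>x. a x *\<^sub>R grad \<Omega> u x)"
proof -
  have meas_\<Omega>: "\<Omega> \<in> sets lebesgue"
    using open_\<Omega> by simp
  have "(\<forall>v. H1_0 \<Omega> v \<longrightarrow> weighted_inner \<Omega> a (grad \<Omega> u) (grad \<Omega> v) = 0)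
      \<longleftrightarrow> div_free \<Omega> (\<lambda>x. a x *\<^sub>R grad \<Omega> u x)"
    if "H1 \<Omega> u"
  proof
    note grad_L2 = H1_grad(2)[OF that]
    assume orth: "\<forall>v. H1_0 \<Omega> v \<longrightarrow> weighted_inner \<Omega> a (grad \<Omega> u) (grad \<Omega> v) = 0"
    have "weighted_inner \<Omega> a (grad \<Omega> u) D = 0" if test_\<phi>: "test_fun \<Omega> \<phi> D" for \<phi> D
    proof -
      note \<phi>_H1_0 = test_fun_H1_0[OF open_\<Omega> test_\<phi>]
      have "weighted_inner \<Omega> a (grad \<Omega> u) D = weighted_inner \<Omega> a (grad \<Omega> u) (grad \<Omega> \<phi>)"
        using weighted_inner_cong_right[OF a_Linf grad_L2 H1_grad(2)[OF H1_0_imp_H1[OF \<phi>_H1_0(1)]]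
            test_fun_L2_on(2)[OF test_\<phi> meas_\<Omega>] \<phi>_H1_0(2)] ..
      with orth \<phi>_H1_0(1) show ?thesis
        by simp
    qed
    then show "div_free \<Omega> (\<lambda>x. a x *\<^sub>R grad \<Omega> u x)"
      by (simp add: div_free_def weighted_inner_def)
  next
    assume flux_div_free: "div_free \<Omega> (\<lambda>x. a x *\<^sub>R grad \<Omega> u x)"
    show "\<forall>v. H1_0 \<Omega> v \<longrightarrow> weighted_inner \<Omega> a (grad \<Omega> u) (grad \<Omega> v) = 0"
      using div_free_orthogonal_H1_0[OF meas_\<Omega>
          L2_on_scaleR_Linf[OF a_Linf H1_grad(2)[OF that]] flux_div_free]
      by (simp add: weighted_inner_def)
  qed
  then show ?thesis
    by (auto simp: is_sol_def weighted_inner_def)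
qed

lemma test_fun_L2_Cauchy:
  assumes domain: "\<Omega> \<in> sets lebesgue" "bounded \<Omega>" and test_\<phi>: "\<And>k. test_fun \<Omega> (\<phi> k) (D k)"
    and D_Cauchy: "L2_Cauchy \<Omega> D"
  shows "L2_Cauchy \<Omega> \<phi>"
proof -
  obtain R where "R > 0" "\<Omega> \<subseteq> cball 0 R"
    using domain(2) by (auto simp: bounded_pos subset_iff)
  then have "L2_norm_on \<Omega> (\<lambda>x. \<phi> m x - \<phi> n x) \<le> 2 * R * L2_norm_on \<Omega> (\<lambda>x. D m x - D n x)" for m n
    by (intro test_fun_Poincare test_fun_diff test_\<phi> domain) auto
  then show ?thesis
    by (rule L2_Cauchy_dominated[OF D_Cauchy test_fun_L2_on(1)[OF test_\<phi> domain(1)]])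
qed

lemma ex_is_sol:
  assumes domain: "open \<Omega>" "bounded \<Omega>" and a_ell: "elliptic_on \<Omega> a" and H1_F: "H1 \<Omega> F"
  shows "\<exists>u. is_sol \<Omega> a F u"
proof -
  have meas_\<Omega>: "\<Omega> \<in> sets lebesgue"
    using domain(1) by simp
  note a_Linf = elliptic_on_imp_Linf_on[OF a_ell] and grad_F_L2 = H1_grad(2)[OF H1_F]
  define V where "V = {D. \<exists>\<phi>. test_fun \<Omega> \<phi> D}"
  have "V \<noteq> {}" "\<And>D. D \<in> V \<Longrightarrow> L2_on \<Omega> D" "\<And>D E. D \<in> V \<Longrightarrow> E \<in> V \<Longrightarrow> (\<lambda>x. D x + E x) \<in> V"
    "\<And>D t. D \<in> V \<Longrightarrow> (\<lambda>x. t *\<^sub>R D x) \<in> V"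
    unfolding V_def using test_fun_zero test_fun_L2_on(2)[OF _ meas_\<Omega>] test_fun_add test_fun_scaleR
    by blast+
  from ex_energy_projection[OF meas_\<Omega> a_ell grad_F_L2 this] obtain D W
    where D_in_V: "\<And>k. D k \<in> V" and W_lim: "L2_tendsto \<Omega> (\<lambda>k x. grad \<Omega> F x + D k x) W"
      and W_orth: "\<And>E. E \<in> V \<Longrightarrow> weighted_inner \<Omega> a W E = 0"
    by metis
  obtain \<phi> where test_\<phi>: "\<And>k. test_fun \<Omega> (\<phi> k) (D k)"
    using D_in_V unfolding V_def mem_Collect_eq by metis
  have D_lim: "L2_tendsto \<Omega> D (\<lambda>x. W x - grad \<Omega> F x)"
    using L2_tendsto_diff[OF W_lim L2_tendsto_const[OF grad_F_L2]] by simp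
  obtain z where \<phi>_lim: "L2_tendsto \<Omega> \<phi> z"
    by (rule L2_complete[OF meas_\<Omega>
          test_fun_L2_Cauchy[OF meas_\<Omega> domain(2) test_\<phi> L2_tendsto_imp_L2_Cauchy[OF D_lim]]])
  note H1_0_z = H1_0I[OF domain(1) test_\<phi> \<phi>_lim D_lim]
  define u where "u x = F x + z x" for x
  have H1_u: "H1 \<Omega> u" "AE x in lebesgue_on \<Omega>. grad \<Omega> u x = grad \<Omega> F x + grad \<Omega> z x"
    unfolding u_def using H1_add[OF domain(1) H1_F H1_0_imp_H1[OF H1_0_z(1)]] by simp_all
  have W_eq: "AE x in lebesgue_on \<Omega>. a x *\<^sub>R W x = a x *\<^sub>R grad \<Omega> u x"
    using H1_u(2) H1_0_z(2) by eventually_elim simp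
  have "div_free \<Omega> (\<lambda>x. a x *\<^sub>R W x)"
    using W_orth by (auto simp: V_def div_free_def weighted_inner_def)
  then have "div_free \<Omega> (\<lambda>x. a x *\<^sub>R grad \<Omega> u x)"
    using L2_on_scaleR_Linf[OF a_Linf] L2_tendsto_imp_L2_on(2)[OF W_lim] H1_grad(2)[OF H1_u(1)]
    by (intro div_free_cong_AE[OF meas_\<Omega> _ _ W_eq] L2_on_measurable) simp_all
  moreover have "H1_0 \<Omega> (\<lambda>x. u x - F x)"
    using H1_0_z(1) by (simp add: u_def)
  ultimately have "is_sol \<Omega> a F u"
    using H1_u(1) by (simp add: is_sol_iff_div_free[OF domain(1) a_Linf])
  then show ?thesis
    by blast
qed

lemma is_sol_sol:
  assumes "open \<Omega>" "bounded \<Omega>" "elliptic_on \<Omega> a" "H1 \<Omega> F"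
  shows "is_sol \<Omega> a F (sol \<Omega> a F)"
  unfolding sol_def by (rule someI_ex[OF ex_is_sol[OF assms]])

lemma is_sol_weighted_inner_H1_0:
  "is_sol \<Omega> a F u \<Longrightarrow> H1_0 \<Omega> v \<Longrightarrow> weighted_inner \<Omega> a (grad \<Omega> u) (grad \<Omega> v) = 0"
  by (simp add: is_sol_def weighted_inner_def)

lemma is_sol_imp_H1: "is_sol \<Omega> a F u \<Longrightarrow> H1 \<Omega> u"
  by (simp add: is_sol_def)

lemma is_sol_diff_H1_0:
  assumes "open \<Omega>" "is_sol \<Omega> a F u" "is_sol \<Omega> b F v"
  shows "H1_0 \<Omega> (\<lambda>x. u x - v x)"
proof -
  have "H1_0 \<Omega> (\<lambda>x. (u x - F x) - (v x - F x))"
    using assms by (intro H1_0_diff[of \<Omega> "\<lambda>x. u x - F x"]) (simp_all add: is_sol_def)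
  then show ?thesis
    by simp
qed

lemma weighted_inner_grad_diff:
  assumes open_\<Omega>: "open \<Omega>" and a_Linf: "Linf_on \<Omega> a" and f_L2: "L2_on \<Omega> f"
    and H1_u: "H1 \<Omega> u" and H1_v: "H1 \<Omega> v"
  shows "weighted_inner \<Omega> a f (grad \<Omega> (\<lambda>x. u x - v x))
      = weighted_inner \<Omega> a f (grad \<Omega> u) - weighted_inner \<Omega> a f (grad \<Omega> v)"
proof -
  note grad_L2 = H1_grad(2)[OF H1_u] H1_grad(2)[OF H1_v]
  note H1_uv = H1_diff[OF open_\<Omega> H1_u H1_v]
  show ?thesis
    unfolding weighted_inner_diff_right[OF a_Linf grad_L2 f_L2, symmetric]
    by (rule weighted_inner_cong_right[OF a_Linf f_L2 H1_grad(2)[OF H1_uv(1)]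
          L2_on_diff[OF grad_L2] H1_uv(2)])
qed

lemma is_sol_weighted_inner_same_boundary:
  assumes "open \<Omega>" "Linf_on \<Omega> a" "is_sol \<Omega> a F u" "is_sol \<Omega> b G v" "is_sol \<Omega> c G w"
  shows "weighted_inner \<Omega> a (grad \<Omega> u) (grad \<Omega> v) = weighted_inner \<Omega> a (grad \<Omega> u) (grad \<Omega> w)"
  using weighted_inner_grad_diff[OF assms(1,2) H1_grad(2)] assms(3-5)[THEN is_sol_imp_H1]
    is_sol_weighted_inner_H1_0[OF assms(3) is_sol_diff_H1_0[OF assms(1,4,5)]] by simp

section \<open>The Dirichlet-to-Neumann form and its linearisation error\<close>

lemma DN_eq_weighted_inner:
  "DN \<Omega> a F G = weighted_inner \<Omega> a (grad \<Omega> (sol \<Omega> a F)) (grad \<Omega> (sol \<Omega> a G))"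
  by (simp add: DN_def weighted_inner_def)

lemma DNd_eq_weighted_inner:
  "DNd \<Omega> a b F G = weighted_inner \<Omega> b (grad \<Omega> (sol \<Omega> a F)) (grad \<Omega> (sol \<Omega> a G))"
  by (simp add: DNd_def weighted_inner_def)

lemma DN_diff_eq_weighted_inner:
  assumes domain: "open \<Omega>" "bounded \<Omega>" and elliptic: "elliptic_on \<Omega> a" "elliptic_on \<Omega> d"
    and H1_F: "H1 \<Omega> F" and H1_G: "H1 \<Omega> G"
  shows "DN \<Omega> a F G - DN \<Omega> d F G
    = weighted_inner \<Omega> (\<lambda>x. a x - d x) (grad \<Omega> (sol \<Omega> a F)) (grad \<Omega> (sol \<Omega> d G))"
proof -
  note Linf = elliptic[THEN elliptic_on_imp_Linf_on]
  note sols = is_sol_sol[OF domain elliptic(1) H1_F] is_sol_sol[OF domain elliptic(1) H1_G]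
    is_sol_sol[OF domain elliptic(2) H1_F] is_sol_sol[OF domain elliptic(2) H1_G]
  let ?U = "grad \<Omega> (sol \<Omega> a F)" and ?V = "grad \<Omega> (sol \<Omega> d G)"
  have "DN \<Omega> a F G = weighted_inner \<Omega> a ?U ?V"
    unfolding DN_eq_weighted_inner
    by (rule is_sol_weighted_inner_same_boundary[OF domain(1) Linf(1) sols(1,2,4)])
  moreover have "DN \<Omega> d F G = weighted_inner \<Omega> d ?U ?V"
    unfolding DN_eq_weighted_inner weighted_inner_commute[of \<Omega> d _ ?V]
    by (rule is_sol_weighted_inner_same_boundary[OF domain(1) Linf(2) sols(4,3,1)])
  ultimately show ?thesis
    using weighted_inner_diff_weight[OF Linf sols(1,4)[THEN is_sol_imp_H1, THEN H1_grad(2)]] by simp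
qed

lemma weighted_inner_sol_diff:
  fixes a d :: "'a::euclidean_space \<Rightarrow> real"
  assumes domain: "open \<Omega>" "bounded \<Omega>" and elliptic: "elliptic_on \<Omega> a" "elliptic_on \<Omega> d"
    and H1_F: "H1 \<Omega> F"
  defines "z \<equiv> \<lambda>x. sol \<Omega> a F x - sol \<Omega> d F x"
  shows "weighted_inner \<Omega> (\<lambda>x. a x - d x) (grad \<Omega> (sol \<Omega> a F)) (grad \<Omega> z)
      = - weighted_inner \<Omega> d (grad \<Omega> z) (grad \<Omega> z)"
proof -
  note Linf = elliptic[THEN elliptic_on_imp_Linf_on]
  note sols = is_sol_sol[OF domain elliptic(1) H1_F] is_sol_sol[OF domain elliptic(2) H1_F]
  note sols_H1 = sols[THEN is_sol_imp_H1]
  have H1_0_z: "H1_0 \<Omega> z"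
    unfolding z_def by (rule is_sol_diff_H1_0[OF domain(1) sols])
  note grad_L2 = H1_grad(2)[OF sols_H1(1)] H1_grad(2)[OF H1_0_imp_H1[OF H1_0_z]]
  have "weighted_inner \<Omega> d (grad \<Omega> z) (grad \<Omega> z) = weighted_inner \<Omega> d (grad \<Omega> (sol \<Omega> a F)) (grad \<Omega> z)"
    unfolding weighted_inner_commute[of \<Omega> d "grad \<Omega> (sol \<Omega> a F)"]
    using weighted_inner_grad_diff[OF domain(1) Linf(2) grad_L2(2) sols_H1, folded z_def]
      is_sol_weighted_inner_H1_0[OF sols(2) H1_0_z]
      weighted_inner_commute[of \<Omega> d "grad \<Omega> (sol \<Omega> d F)" "grad \<Omega> z"] by linarith
  then show ?thesis
    using weighted_inner_diff_weight[OF Linf grad_L2] is_sol_weighted_inner_H1_0[OF sols(1) H1_0_z]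
    by simp
qed

lemma Bform_self_eq:
  fixes a d :: "'a::euclidean_space \<Rightarrow> real"
  assumes domain: "open \<Omega>" "bounded \<Omega>" and elliptic: "elliptic_on \<Omega> a" "elliptic_on \<Omega> d"
    and H1_F: "H1 \<Omega> F"
  defines "z \<equiv> \<lambda>x. sol \<Omega> a F x - sol \<Omega> d F x"
  shows "Bform \<Omega> a d F F = weighted_inner \<Omega> d (grad \<Omega> z) (grad \<Omega> z)"
proof -
  note sols = is_sol_sol[OF domain elliptic(1) H1_F] is_sol_sol[OF domain elliptic(2) H1_F]
  note sols_H1 = sols[THEN is_sol_imp_H1]
  have "Bform \<Omega> a d F F = - weighted_inner \<Omega> (\<lambda>x. a x - d x) (grad \<Omega> (sol \<Omega> a F)) (grad \<Omega> z)"
    unfolding Bform_def DN_diff_eq_weighted_inner[OF domain elliptic H1_F H1_F]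
      DNd_eq_weighted_inner z_def
    using weighted_inner_grad_diff[OF domain(1)
        Linf_on_diff[OF elliptic[THEN elliptic_on_imp_Linf_on]] H1_grad(2)[OF sols_H1(1)] sols_H1]
    by simp
  then show ?thesis
    using weighted_inner_sol_diff[OF domain elliptic H1_F] by (simp add: z_def)
qed

lemma weighted_inner_one_div_free:
  assumes "\<Omega> \<in> sets lebesgue" "Linf_on \<Omega> b" "L2_on \<Omega> w" "div_free \<Omega> (\<lambda>x. b x *\<^sub>R w x)" "H1_0 \<Omega> z"
  shows "weighted_inner \<Omega> (\<lambda>x. 1) w (\<lambda>x. b x *\<^sub>R grad \<Omega> z x) = 0"
  using div_free_orthogonal_H1_0[OF assms(1) L2_on_scaleR_Linf[OF assms(2,3)] assms(4,5)]
  by (simp add: weighted_inner_def)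

lemma Bform_le_div_free:
  assumes domain: "open \<Omega>" "bounded \<Omega>" and elliptic: "elliptic_on \<Omega> a" "elliptic_on \<Omega> d"
    and H1_F: "H1 \<Omega> F"
    and w_div_free: "L2_on \<Omega> w" "div_free \<Omega> (\<lambda>x. sqrt (d x) *\<^sub>R w x)"
  shows "Bform \<Omega> a d F F
    \<le> (\<integral>x. (norm (((a x - d x) / sqrt (d x)) *\<^sub>R grad \<Omega> (sol \<Omega> a F) x - w x))\<^sup>2 \<partial>lebesgue_on \<Omega>)"
proof -
  note Linf = elliptic[THEN elliptic_on_imp_Linf_on] and d_pos = elliptic_on_AE_pos[OF elliptic(2)]
  note sols = is_sol_sol[OF domain elliptic(1) H1_F] is_sol_sol[OF domain elliptic(2) H1_F]
  define z where "z = (\<lambda>x. sol \<Omega> a F x - sol \<Omega> d F x)"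
  define b where "b x = (a x - d x) / sqrt (d x)" for x
  let ?U = "grad \<Omega> (sol \<Omega> a F)" and ?Z = "grad \<Omega> z"
  let ?X = "\<lambda>x. b x *\<^sub>R ?U x - w x" and ?Y = "\<lambda>x. sqrt (d x) *\<^sub>R ?Z x"
  have H1_0_z: "H1_0 \<Omega> z"
    unfolding z_def by (rule is_sol_diff_H1_0[OF domain(1) sols])
  have b_Linf: "Linf_on \<Omega> b"
    unfolding b_def by (intro Linf_on_divide Linf_on_diff Linf elliptic_on_sqrt elliptic)
  note sqrt_Linf = Linf_on_sqrt[OF Linf(2)]
  note U_L2 = H1_grad(2)[OF is_sol_imp_H1[OF sols(1)]] and Z_L2 = H1_grad(2)[OF H1_0_imp_H1[OF H1_0_z]]
  note bU_L2 = L2_on_scaleR_Linf[OF b_Linf U_L2] and Y_L2 = L2_on_scaleR_Linf[OF sqrt_Linf Z_L2]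
  note X_L2 = L2_on_diff[OF bU_L2 w_div_free(1)]
  have inner_Y_Y: "weighted_inner \<Omega> (\<lambda>x. 1) ?Y ?Y = weighted_inner \<Omega> d ?Z ?Z"
    by (rule weighted_inner_one_scaleR[OF sqrt_Linf sqrt_Linf Linf(2) Z_L2 Z_L2])
       (use d_pos in \<open>eventually_elim, simp\<close>)
  have "weighted_inner \<Omega> (\<lambda>x. 1) (\<lambda>x. b x *\<^sub>R ?U x) ?Y = weighted_inner \<Omega> (\<lambda>x. a x - d x) ?U ?Z"
    by (rule weighted_inner_one_scaleR[OF b_Linf sqrt_Linf Linf_on_diff[OF Linf] U_L2 Z_L2])
       (use d_pos in \<open>eventually_elim, simp add: b_def\<close>)
  also have "\<dots> = - weighted_inner \<Omega> d ?Z ?Z"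
    unfolding z_def by (rule weighted_inner_sol_diff[OF domain elliptic H1_F])
  moreover have "weighted_inner \<Omega> (\<lambda>x. 1) w ?Y = 0"
    by (rule weighted_inner_one_div_free[OF _ sqrt_Linf w_div_free H1_0_z]) (use domain(1) in simp)
  ultimately have inner_X_Y: "weighted_inner \<Omega> (\<lambda>x. 1) ?X ?Y = - weighted_inner \<Omega> d ?Z ?Z"
    using weighted_inner_diff_left[OF Linf_on_const bU_L2 w_div_free(1) Y_L2] by simp
  have "0 \<le> weighted_inner \<Omega> (\<lambda>x. 1) (\<lambda>x. ?X x + ?Y x) (\<lambda>x. ?X x + ?Y x)"
    by (rule weighted_inner_self_nonneg) simp
  also have "\<dots> = weighted_inner \<Omega> (\<lambda>x. 1) ?X ?X - weighted_inner \<Omega> d ?Z ?Z"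
    unfolding weighted_inner_add_self[OF Linf_on_const X_L2 Y_L2] inner_X_Y inner_Y_Y by simp
  also have "weighted_inner \<Omega> d ?Z ?Z = Bform \<Omega> a d F F"
    unfolding z_def by (rule Bform_self_eq[OF domain elliptic H1_F, symmetric])
  finally show ?thesis
    by (simp add: weighted_inner_one_self b_def)
qed

lemma div_free_scaled_flux:
  assumes open_\<Omega>: "open \<Omega>" and c_Linf: "Linf_on \<Omega> c" and h_sol: "is_sol \<Omega> c G h"
    and b_ell: "elliptic_on \<Omega> b"
  shows "div_free \<Omega> (\<lambda>x. b x *\<^sub>R ((c x / b x) *\<^sub>R grad \<Omega> h x))"
proof (rule div_free_cong_AE)
  note H_L2 = H1_grad(2)[OF is_sol_imp_H1[OF h_sol]]
  show "\<Omega> \<in> sets lebesgue"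
    using open_\<Omega> by simp
  show "div_free \<Omega> (\<lambda>x. c x *\<^sub>R grad \<Omega> h x)"
    using h_sol by (simp add: is_sol_iff_div_free[OF open_\<Omega> c_Linf])
  show "AE x in lebesgue_on \<Omega>. c x *\<^sub>R grad \<Omega> h x = b x *\<^sub>R ((c x / b x) *\<^sub>R grad \<Omega> h x)"
    using elliptic_on_AE_pos[OF b_ell] by eventually_elim simp
  show "(\<lambda>x. c x *\<^sub>R grad \<Omega> h x) \<in> borel_measurable (lebesgue_on \<Omega>)"
    "(\<lambda>x. b x *\<^sub>R ((c x / b x) *\<^sub>R grad \<Omega> h x)) \<in> borel_measurable (lebesgue_on \<Omega>)"
    by (intro L2_on_measurable L2_on_scaleR_Linf Linf_on_divide elliptic_on_imp_Linf_on c_Linf b_ell H_L2)+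
qed

text \<open>The choice \<open>w = c / sqrt d *\<^sub>R grad \<Omega> h\<close> is admissible because \<open>h\<close> solves the equation for \<open>c\<close>.\<close>
lemma Bform_le_weighted_inner:
  assumes domain: "open \<Omega>" "bounded \<Omega>" and elliptic: "elliptic_on \<Omega> a" "elliptic_on \<Omega> d"
    and H1_F: "H1 \<Omega> F"
    and c_Linf: "Linf_on \<Omega> c" and h_sol: "is_sol \<Omega> c G h"
  shows "Bform \<Omega> a d F F \<le> DNd \<Omega> a (\<lambda>x. \<bar>a x - d x\<bar>\<^sup>2 / d x) F F
      - 2 * weighted_inner \<Omega> (\<lambda>x. (a x - d x) * c x / d x) (grad \<Omega> (sol \<Omega> a F)) (grad \<Omega> h)
      + weighted_inner \<Omega> (\<lambda>x. (c x)\<^sup>2 / d x) (grad \<Omega> h) (grad \<Omega> h)"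
proof -
  note Linf = elliptic[THEN elliptic_on_imp_Linf_on] and d_pos = elliptic_on_AE_pos[OF elliptic(2)]
  define b where "b x = (a x - d x) / sqrt (d x)" for x
  define e where "e x = c x / sqrt (d x)" for x
  let ?U = "grad \<Omega> (sol \<Omega> a F)" and ?H = "grad \<Omega> h"
  have be_Linf: "Linf_on \<Omega> b" "Linf_on \<Omega> e"
    unfolding b_def e_def by (intro Linf_on_divide Linf_on_diff Linf c_Linf elliptic_on_sqrt elliptic)+
  have quot_Linf: "Linf_on \<Omega> (\<lambda>x. \<bar>a x - d x\<bar>\<^sup>2 / d x)" "Linf_on \<Omega> (\<lambda>x. (a x - d x) * c x / d x)"
    "Linf_on \<Omega> (\<lambda>x. (c x)\<^sup>2 / d x)"
    unfolding power2_abs unfolding power2_eq_square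
    by (intro Linf_on_divide Linf_on_mult Linf_on_diff Linf c_Linf elliptic)+
  note U_L2 = H1_grad(2)[OF is_sol_imp_H1[OF is_sol_sol[OF domain elliptic(1) H1_F]]]
    and H_L2 = H1_grad(2)[OF is_sol_imp_H1[OF h_sol]]
  note bU_L2 = L2_on_scaleR_Linf[OF be_Linf(1) U_L2] and eH_L2 = L2_on_scaleR_Linf[OF be_Linf(2) H_L2]
  have "div_free \<Omega> (\<lambda>x. sqrt (d x) *\<^sub>R (e x *\<^sub>R ?H x))"
    unfolding e_def
    by (rule div_free_scaled_flux[OF domain(1) c_Linf h_sol elliptic_on_sqrt[OF elliptic(2)]])
  then have "Bform \<Omega> a d F F
      \<le> weighted_inner \<Omega> (\<lambda>x. 1) (\<lambda>x. b x *\<^sub>R ?U x - e x *\<^sub>R ?H x) (\<lambda>x. b x *\<^sub>R ?U x - e x *\<^sub>R ?H x)"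
    using Bform_le_div_free[OF domain elliptic H1_F eH_L2] by (simp only: weighted_inner_one_self b_def)
  also have "\<dots> = weighted_inner \<Omega> (\<lambda>x. 1) (\<lambda>x. b x *\<^sub>R ?U x) (\<lambda>x. b x *\<^sub>R ?U x)
      - 2 * weighted_inner \<Omega> (\<lambda>x. 1) (\<lambda>x. b x *\<^sub>R ?U x) (\<lambda>x. e x *\<^sub>R ?H x)
      + weighted_inner \<Omega> (\<lambda>x. 1) (\<lambda>x. e x *\<^sub>R ?H x) (\<lambda>x. e x *\<^sub>R ?H x)"
    by (rule weighted_inner_diff_self[OF Linf_on_const bU_L2 eH_L2])
  also have "weighted_inner \<Omega> (\<lambda>x. 1) (\<lambda>x. b x *\<^sub>R ?U x) (\<lambda>x. b x *\<^sub>R ?U x)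
      = DNd \<Omega> a (\<lambda>x. \<bar>a x - d x\<bar>\<^sup>2 / d x) F F"
    unfolding DNd_eq_weighted_inner
    by (rule weighted_inner_one_scaleR[OF be_Linf(1) be_Linf(1) quot_Linf(1) U_L2 U_L2])
       (use d_pos in \<open>eventually_elim, simp add: b_def power2_eq_square\<close>)
  also have "weighted_inner \<Omega> (\<lambda>x. 1) (\<lambda>x. b x *\<^sub>R ?U x) (\<lambda>x. e x *\<^sub>R ?H x)
      = weighted_inner \<Omega> (\<lambda>x. (a x - d x) * c x / d x) ?U ?H"
    by (rule weighted_inner_one_scaleR[OF be_Linf quot_Linf(2) U_L2 H_L2])
       (use d_pos in \<open>eventually_elim, simp add: b_def e_def\<close>)
  also have "weighted_inner \<Omega> (\<lambda>x. 1) (\<lambda>x. e x *\<^sub>R ?H x) (\<lambda>x. e x *\<^sub>R ?H x)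
      = weighted_inner \<Omega> (\<lambda>x. (c x)\<^sup>2 / d x) ?H ?H"
    by (rule weighted_inner_one_scaleR[OF be_Linf(2) be_Linf(2) quot_Linf(3) H_L2 H_L2])
       (use d_pos in \<open>eventually_elim, simp add: e_def power2_eq_square\<close>)
  finally show ?thesis .
qed

lemma Bform_le_Inf_div_free:
  assumes "open \<Omega>" "bounded \<Omega>" "elliptic_on \<Omega> a" "elliptic_on \<Omega> d" "H1 \<Omega> F"
  shows "Bform \<Omega> a d F F
    \<le> Inf {(\<integral>x. (norm (((a x - d x) / sqrt (d x)) *\<^sub>R grad \<Omega> (sol \<Omega> a F) x - w x))\<^sup>2 \<partial>lebesgue_on \<Omega>)
        | w. L2_on \<Omega> w \<and> div_free \<Omega> (\<lambda>x. sqrt (d x) *\<^sub>R w x)}" (is "_ \<le> Inf ?S")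
proof (rule cInf_greatest)
  have "L2_on \<Omega> (\<lambda>x. 0 :: 'a) \<and> div_free \<Omega> (\<lambda>x. sqrt (d x) *\<^sub>R (0 :: 'a))"
    by (simp add: L2_on_zero div_free_def)
  then show "?S \<noteq> {}"
    by blast
  show "Bform \<Omega> a d F F \<le> y" if "y \<in> ?S" for y
    using that Bform_le_div_free[OF assms] by blast
qed

lemma Bform_le_DN:
  assumes domain: "open \<Omega>" "bounded \<Omega>" and elliptic: "elliptic_on \<Omega> a" "elliptic_on \<Omega> d"
    and H1_F: "H1 \<Omega> F" and H1_G: "H1 \<Omega> G"
  shows "Bform \<Omega> a d F F
    \<le> DNd \<Omega> a (\<lambda>x. \<bar>a x - d x\<bar>\<^sup>2 / d x) F F - 2 * (DN \<Omega> a F G - DN \<Omega> d F G) + DN \<Omega> d G G"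
proof -
  note Linf = elliptic[THEN elliptic_on_imp_Linf_on]
    and sols = is_sol_sol[OF domain elliptic(1) H1_F] is_sol_sol[OF domain elliptic(2) H1_G]
  note [measurable] = Linf[THEN Linf_on_measurable]
  let ?U = "grad \<Omega> (sol \<Omega> a F)" and ?V = "grad \<Omega> (sol \<Omega> d G)"
  have "weighted_inner \<Omega> (\<lambda>x. (a x - d x) * d x / d x) ?U ?V = DN \<Omega> a F G - DN \<Omega> d F G"
    unfolding DN_diff_eq_weighted_inner[OF domain elliptic H1_F H1_G]
  proof (rule weighted_inner_cong_weight[OF _ _ sols[THEN is_sol_imp_H1, THEN H1_grad(2)]])
    show "AE x in lebesgue_on \<Omega>. (a x - d x) * d x / d x = a x - d x"
      using elliptic_on_AE_pos[OF elliptic(2)] by eventually_elim simp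
  qed measurable
  moreover have "weighted_inner \<Omega> (\<lambda>x. (d x)\<^sup>2 / d x) ?V ?V = DN \<Omega> d G G"
    by (simp add: DN_eq_weighted_inner power2_eq_square)
  ultimately show ?thesis
    using Bform_le_weighted_inner[OF domain elliptic H1_F Linf(2) sols(2)] by simp
qed

lemma Bform_le_DNd:
  assumes domain: "open \<Omega>" "bounded \<Omega>" and elliptic: "elliptic_on \<Omega> a" "elliptic_on \<Omega> d"
    and H1_F: "H1 \<Omega> F" and H1_G: "H1 \<Omega> G"
  shows "Bform \<Omega> a d F F \<le> DNd \<Omega> a (\<lambda>x. \<bar>a x - d x\<bar>\<^sup>2 / d x) F F
    - 2 * DNd \<Omega> a (\<lambda>x. (a x - d x) * a x / d x) F G + DNd \<Omega> a (\<lambda>x. (a x)\<^sup>2 / d x) G G"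
  using Bform_le_weighted_inner[OF domain elliptic H1_F
      elliptic_on_imp_Linf_on[OF elliptic(1)] is_sol_sol[OF domain elliptic(1) H1_G]]
  by (simp only: DNd_eq_weighted_inner)

theorem theorem2:
  fixes \<Omega> :: "'a::euclidean_space set" and lo hi :: real
    and I :: "nat set" and fam :: "nat \<Rightarrow> 'a \<Rightarrow> real"
    and \<gamma> \<gamma>d :: "'a \<Rightarrow> real"
  assumes "lipschitz_domain \<Omega>" and "0 < lo" and "lo \<le> hi"
    and "orthonormal_fam \<Omega> I fam"
    and "in_DF \<Omega> lo hi I fam \<gamma>" and "in_DF \<Omega> lo hi I fam \<gamma>d"
    and "\<exists>c<1. AE x in lebesgue_on \<Omega>. \<bar>\<gamma> x - \<gamma>d x\<bar> / \<gamma>d x \<le> c"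
  shows
    "(\<forall>F. H1 \<Omega> F \<longrightarrow>
        Bform \<Omega> \<gamma> \<gamma>d F F \<le>
          Inf {integral\<^sup>L (lebesgue_on \<Omega>)
                 (\<lambda>x. (norm (((\<gamma> x - \<gamma>d x) / sqrt (\<gamma>d x)) *\<^sub>R grad \<Omega> (sol \<Omega> \<gamma> F) x - w x))\<^sup>2)
               | w. L2_on \<Omega> w \<and> div_free \<Omega> (\<lambda>x. sqrt (\<gamma>d x) *\<^sub>R w x)})
     \<and> (\<forall>F G. H1 \<Omega> F \<longrightarrow> H1 \<Omega> G \<longrightarrow>
        Bform \<Omega> \<gamma> \<gamma>d F F \<le>
          DNd \<Omega> \<gamma> (\<lambda>x. \<bar>\<gamma> x - \<gamma>d x\<bar>\<^sup>2 / \<gamma>d x) F F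
          - 2 * (DN \<Omega> \<gamma> F G - DN \<Omega> \<gamma>d F G) + DN \<Omega> \<gamma>d G G)
     \<and> (\<forall>F G. H1 \<Omega> F \<longrightarrow> H1 \<Omega> G \<longrightarrow>
        Bform \<Omega> \<gamma> \<gamma>d F F \<le>
          DNd \<Omega> \<gamma> (\<lambda>x. \<bar>\<gamma> x - \<gamma>d x\<bar>\<^sup>2 / \<gamma>d x) F F
          - 2 * DNd \<Omega> \<gamma> (\<lambda>x. (\<gamma> x - \<gamma>d x) * \<gamma> x / \<gamma>d x) F G
          + DNd \<Omega> \<gamma> (\<lambda>x. (\<gamma> x)\<^sup>2 / \<gamma>d x) G G)"
proof -
  have domain: "open \<Omega>" "bounded \<Omega>"
    using assms(1) by (simp_all add: lipschitz_domain_def)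
  have "conductivity \<Omega> lo hi \<gamma>" "conductivity \<Omega> lo hi \<gamma>d"
    using assms(5,6) by (simp_all add: in_DF_def)
  then have elliptic: "elliptic_on \<Omega> \<gamma>" "elliptic_on \<Omega> \<gamma>d"
    using \<open>0 < lo\<close> by (simp_all add: conductivity_imp_elliptic_on)
  show ?thesis
    by (intro conjI allI impI Bform_le_Inf_div_free[OF domain elliptic]
        Bform_le_DN[OF domain elliptic] Bform_le_DNd[OF domain elliptic])
qed

end
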